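(* The applicative structures $\langle\mathfrak{D}_\infty,\bullet\rangle$ and $\langle D_\infty,\bullet\rangle$ are isomorphic (there is a bijection $D_\infty\to\mathfrak{D}_\infty$ preserving $\bullet$). Consequently $\langle\mathfrak{D}_\infty,\bullet\rangle$ is an extensional $\lambda$-model, i.e. there is an interpretation $\llbracket\,\rrbracket$ such that $\langle\mathfrak{D}_\infty,\bullet,\llbracket\,\rrbracket\rangle$ is an extensional $\lambda$-model.
   Context: **Scott's $D_\infty$.** A c.p.o. is a partially ordered set with a least element in which every (non-empty) directed subset has a least upper bound. The Scott topology on a c.p.o. has as open sets the upward closed sets $A$ such that $\bigsqcup X\in A$ implies $X\cap A\neq\emptyset$ for every directed $X$. $[D\to D']$ is the c.p.o. of functions preserving least upper bounds of directed sets, ordered pointwise. $\mathbb{N}^+=\mathbb{N}\cup\{\perp\}$ with $a\sqsubseteq b$ iff $a=\perp$ or $a=b$. Put $D_0=\mathbb{N}^+$, $D_{n+1}=[D_n\to D_n]$, and let $\perp_n$ be the least element of $D_n$. Define $\phi_n\in[D_n\to D_{n+1}]$ and $\psi_n\in[D_{n+1}\to D_n]$ by: $\phi_0(d)$ is the constant function with value $d$; $\psi_0(g)=g(\perp_0)$; $\phi_{n+1}(d)=\phi_n\circ d\circ\psi_n$; $\psi_{n+1}(g)=\psi_n\circ g\circ\phi_n$. $D_\infty$ is the c.p.o. of all sequences $d=\langle d_0,d_1,\dots\rangle$ with $d_n\in D_n$ and $\psi_n(d_{n+1})=d_n$ for all $n$, ordered componentwise, with the Scott topology. For $x\in D_n$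 let $\phi_{n,\infty}(x)\in D_\infty$ be the sequence whose $m$-th entry is $\psi_m\circ\cdots\circ\psi_{n-1}(x)$ for $m<n$, $x$ for $m=n$, and $\phi_{m-1}\circ\cdots\circ\phi_n(x)$ for $m>n$. Application in $D_\infty$ is $a\bullet b=\bigsqcup_{n\ge0}\phi_{n,\infty}(a_{n+1}(b_n))$. It is known that $\langle D_\infty,\bullet\rangle$ is an extensional $\lambda$-model. **$\mathfrak{D}_\infty$.** For $d\in D_\infty$ put $\pi_0(D_\infty,d):=d$ and, for $n\ge1$, let $\pi_n(D_\infty,d)$ be the set of homotopy classes (relative to the boundary) of continuous maps $[0,1]^n\to D_\infty$ sending $\partial([0,1]^n)$ to $d$. Let $\mathfrak{D}_n=\{\pi_n(D_\infty,d):d\in D_\infty\}$ and $s(\pi_{n+1}(D_\infty,d))=t(\pi_{n+1}(D_\infty,d))=\pi_n(D_\infty,d)$. Elements of $\mathfrak{D}_n$ are compared by equality, not up to isomorphism: $\pi_n(D_\infty,d)=\pi_n(D_\infty,d')$ iff $d=d'$. $\mathfrak{D}_\infty$ is the set of all sequences $\mathfrak{d}=\langle\mathfrak{d}_0,\mathfrak{d}_1,\dots\rangle$ with $\mathfrak{d}_n\in\mathfrak{D}_n$ and $s(\mathfrak{d}_{n+1})=t(\mathfrak{d}_{n+1})=\mathfrak{d}_n$ for all $n$; for each such $\mathfrak{d}$ there is a unique $d\in D_\infty$ with $\mathfrak{d}_n=\pi_n(D_\infty,d)$ for all $n$. Application in $\mathfrak{D}_\infty$: $\pi_n(D_\infty,a)\bullet\pi_n(D_\infty,b):=\pi_n(D_\infty,a\bullet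 b)$ and $\mathfrak{a}\bullet\mathfrak{b}=\langle\mathfrak{a}_0\bullet\mathfrak{b}_0,\mathfrak{a}_1\bullet\mathfrak{b}_1,\dots\rangle$. **$\lambda$-model.** A triple $\langle D,\bullet,\llbracket\,\rrbracket\rangle$, where $D$ is a set with at least two elements, $\bullet$ is a binary operation on $D$, and $\llbracket\,\rrbracket$ assigns to each untyped $\lambda$-term $M$ and each assignment $\rho:\mathrm{Var}\to D$ an element $\llbracket M\rrbracket_\rho\in D$ such that: (1) $\llbracket x\rrbracket_\rho=\rho(x)$; (2) $\llbracket PQ\rrbracket_\rho=\llbracket P\rrbracket_\rho\bullet\llbracket Q\rrbracket_\rho$; (3) $\llbracket\lambda x.P\rrbracket_\rho\bullet d=\llbracket P\rrbracket_{[d/x]\rho}$ for all $d\in D$; (4) $\llbracket M\rrbracket_\rho=\llbracket M\rrbracket_\sigma$ if $\rho,\sigma$ agree on $FV(M)$; (5) $\llbracket\lambda x.M\rrbracket_\rho=\llbracket\lambda y.[y/x]M\rrbracket_\rho$ if $y\notin FV(M)$; (6) if $\llbracket P\rrbracket_{[d/x]\rho}=\llbracket Q\rrbracket_{[d/x]\rho}$ for all $d\in D$, then $\llbracket\lambda x.P\rrbracket_\rho=\llbracket\lambda x.Q\rrbracket_\rho$. It is extensional if moreover $\llbracket\lambda x.Mx\rrbracket_\rho=\llbracket M\rrbracket_\rho$ whenever $x\notin FV(M)$. Here $[d/x]\rho$ is $\rho$ modified to send $x$ to $d$. *)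

theory Defs
  imports "HOL-Analysis.Analysis" "HOL-Algebra.Lattice"
begin

section \<open>C.p.o.s and Scott continuity\<close>

definition directed :: "('a, 'b) gorder_scheme \<Rightarrow> 'a set \<Rightarrow> bool" where
  "directed L X \<longleftrightarrow> X \<subseteq> carrier L \<and> X \<noteq> {} \<and>
     (\<forall>x\<in>X. \<forall>y\<in>X. \<exists>z\<in>X. x \<sqsubseteq>\<^bsub>L\<^esub> z \<and> y \<sqsubseteq>\<^bsub>L\<^esub> z)"

locale cpo = partial_order +
  assumes bottom_exists: "\<exists>b. least L b (carrier L)"
    and directed_lub_exists: "directed L X \<Longrightarrow> \<exists>u. is_lub L u X"

definition scott_continuous ::
    "('a, 'c) gorder_scheme \<Rightarrow> ('b, 'd) gorder_scheme \<Rightarrow> ('a \<Rightarrow> 'b) \<Rightarrow> bool" where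
  "scott_continuous L M f \<longleftrightarrow> f \<in> carrier L \<rightarrow> carrier M \<and>
     (\<forall>X u. directed L X \<longrightarrow> is_lub L u X \<longrightarrow> is_lub M (f u) (f ` X))"

definition scott_open :: "('a, 'b) gorder_scheme \<Rightarrow> 'a set \<Rightarrow> bool" where
  "scott_open L U \<longleftrightarrow> U \<subseteq> carrier L \<and>
     (\<forall>x\<in>U. \<forall>y\<in>carrier L. x \<sqsubseteq>\<^bsub>L\<^esub> y \<longrightarrow> y \<in> U) \<and>
     (\<forall>X u. directed L X \<longrightarrow> is_lub L u X \<longrightarrow> u \<in> U \<longrightarrow> X \<inter> U \<noteq> {})"

definition scott_topology :: "('a, 'b) gorder_scheme \<Rightarrow> 'a topology" where
  "scott_topology L = topology (scott_open L)"

lemma openin_scott_topology: "openin (scott_topology L) U \<longleftrightarrow> scott_open L U"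
proof -
  have "istopology (scott_open L)"
    unfolding istopology_def
  proof (intro conjI allI impI)
    fix S T assume S: "scott_open L S" and T: "scott_open L T"
    show "scott_open L (S \<inter> T)"
      unfolding scott_open_def
    proof (intro conjI allI impI ballI)
      show "S \<inter> T \<subseteq> carrier L" using S by (auto simp: scott_open_def)
    next
      fix x y assume "x \<in> S \<inter> T" "y \<in> carrier L" "x \<sqsubseteq>\<^bsub>L\<^esub> y"
      then show "y \<in> S \<inter> T" using S T unfolding scott_open_def by blast
    next
      fix X u assume X: "directed L X" and u: "is_lub L u X" and "u \<in> S \<inter> T"
      then obtain x y where x: "x \<in> X" "x \<in> S" and y: "y \<in> X" "y \<in> T"
        using S T unfolding scott_open_def by (metis IntD1 IntD2 disjoint_iff)
      then obtain z where z: "z \<in> X" "x \<sqsubseteq>\<^bsub>L\<^esub> z" "y \<sqsubseteq>\<^bsub>L\<^esub> z" "z \<in> carrier L"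
        using X unfolding directed_def by blast
      then have "z \<in> S \<inter> T" using S T x y unfolding scott_open_def by blast
      then show "X \<inter> (S \<inter> T) \<noteq> {}" using z by blast
    qed
  next
    fix K assume K: "\<forall>S\<in>K. scott_open L S"
    show "scott_open L (\<Union> K)"
      unfolding scott_open_def
    proof (intro conjI allI impI ballI)
      show "\<Union> K \<subseteq> carrier L" using K by (auto simp: scott_open_def)
    next
      fix x y assume "x \<in> \<Union> K" "y \<in> carrier L" "x \<sqsubseteq>\<^bsub>L\<^esub> y"
      then show "y \<in> \<Union> K" using K unfolding scott_open_def by blast
    next
      fix X u assume X: "directed L X" and u: "is_lub L u X" and "u \<in> \<Union> K"
      then obtain S where S: "S \<in> K" "u \<in> S" by blast
      with K X u have "X \<inter> S \<noteq> {}" unfolding scott_open_def by blast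
      with S show "X \<inter> \<Union> K \<noteq> {}" by blast
    qed
  qed
  then show ?thesis by (simp add: scott_topology_def topology_inverse')
qed

section \<open>The c.p.o.s \<open>D\<^sub>n\<close>\<close>

text \<open>
  A single type that contains every \<open>D\<^sub>n\<close>. A function is represented by its graph, and
  \<open>Graph e\<close> stands for the set of pairs \<open>range e\<close>. Indexing by \<^typ>\<open>nat set\<close> suffices since every
  \<open>D\<^sub>n\<close> has at most the cardinality of the continuum (lemma \<open>D_small\<close>). As several \<open>e\<close> have the
  same range, \<open>fn A f\<close> picks one canonical code for the function \<open>f\<close> with domain \<open>A\<close>.
\<close>

datatype scott = Bot | Num nat | Graph "nat set \<Rightarrow> scott \<times> scott"

primrec graph :: "scott \<Rightarrow> (scott \<times> scott) set" where
  "graph Bot = {}"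
| "graph (Num k) = {}"
| "graph (Graph e) = range e"

definition fn :: "scott set \<Rightarrow> (scott \<Rightarrow> scott) \<Rightarrow> scott" where
  "fn A f = (SOME x. graph x = (\<lambda>d. (d, f d)) ` A)"

definition ap :: "scott \<Rightarrow> scott \<Rightarrow> scott" where
  "ap x d = (THE y. (d, y) \<in> graph x)"

definition flat_nat :: "scott gorder" where
  "flat_nat = \<lparr>carrier = insert Bot (range Num), eq = (=), le = (\<lambda>a b. a = Bot \<or> a = b)\<rparr>"

definition fun_space :: "scott gorder \<Rightarrow> scott gorder" where
  "fun_space L = \<lparr>carrier = {fn (carrier L) f | f. scott_continuous L L f},
     eq = (=), le = (\<lambda>f g. \<forall>d\<in>carrier L. ap f d \<sqsubseteq>\<^bsub>L\<^esub> ap g d)\<rparr>"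

primrec D :: "nat \<Rightarrow> scott gorder" where
  "D 0 = flat_nat"
| "D (Suc n) = fun_space (D n)"

subsection \<open>Adequacy of the encoding\<close>

text \<open>
  The lemmas \<open>D_cpo\<close>, \<open>D_small\<close> and \<open>D_Suc_bij\<close> below show that each \<open>D n\<close> is a c.p.o. and that
  \<open>ap\<close> identifies \<open>D (Suc n)\<close> with the set of all Scott continuous functions on \<open>D n\<close>. To bound
  the cardinality, each \<open>D n\<close> is equipped with an increasing sequence of continuous maps with
  finite image whose pointwise least upper bound is the identity.
\<close>

definition small :: "scott set \<Rightarrow> bool" where
  "small A \<longleftrightarrow> A \<noteq> {} \<and> (\<exists>c :: scott \<Rightarrow> nat set. inj_on c A)"

lemma graph_fn:
  assumes "small A" shows "graph (fn A f) = (\<lambda>d. (d, f d)) ` A"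
proof -
  obtain c :: "scott \<Rightarrow> nat set" and a where c: "inj_on c A" and a: "a \<in> A"
    using assms unfolding small_def by blast
  define e where "e s = (let d = (if s \<in> c ` A then inv_into A c s else a) in (d, f d))" for s
  have "range e \<subseteq> (\<lambda>d. (d, f d)) ` A"
    using a by (auto simp: e_def Let_def inv_into_into)
  moreover have "(d, f d) = e (c d)" if "d \<in> A" for d
    using that c by (simp add: e_def inv_into_f_f)
  then have "(\<lambda>d. (d, f d)) ` A \<subseteq> range e" by blast
  ultimately have "graph (Graph e) = (\<lambda>d. (d, f d)) ` A" by simp
  then show ?thesis unfolding fn_def by (rule someI)
qed

lemma ap_fn: "small A \<Longrightarrow> d \<in> A \<Longrightarrow> ap (fn A f) d = f d"
  unfolding ap_def by (subst graph_fn) auto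

lemma fn_cong: "(\<And>d. d \<in> A \<Longrightarrow> f d = g d) \<Longrightarrow> fn A f = fn A g"
proof -
  assume "\<And>d. d \<in> A \<Longrightarrow> f d = g d"
  then have "(\<lambda>d. (d, f d)) ` A = (\<lambda>d. (d, g d)) ` A" by (intro image_cong) auto
  then show ?thesis by (simp add: fn_def)
qed

lemma is_lubD:
  assumes "is_lub L u X" "X \<subseteq> carrier L"
  shows "u \<in> carrier L" "\<And>x. x \<in> X \<Longrightarrow> x \<sqsubseteq>\<^bsub>L\<^esub> u"
    "\<And>v. v \<in> carrier L \<Longrightarrow> (\<And>x. x \<in> X \<Longrightarrow> x \<sqsubseteq>\<^bsub>L\<^esub> v) \<Longrightarrow> u \<sqsubseteq>\<^bsub>L\<^esub> v"
  using assms by (auto simp: least_def Upper_def)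

lemma is_lubI:
  assumes "u \<in> carrier L" "\<And>x. x \<in> X \<Longrightarrow> x \<sqsubseteq>\<^bsub>L\<^esub> u"
    "\<And>v. v \<in> carrier L \<Longrightarrow> (\<And>x. x \<in> X \<Longrightarrow> x \<in> carrier L \<Longrightarrow> x \<sqsubseteq>\<^bsub>L\<^esub> v) \<Longrightarrow> u \<sqsubseteq>\<^bsub>L\<^esub> v"
  shows "is_lub L u X"
  using assms by (auto simp: least_def Upper_def)

lemma scott_continuous_car: "scott_continuous L M f \<Longrightarrow> x \<in> carrier L \<Longrightarrow> f x \<in> carrier M"
  unfolding scott_continuous_def by blast

lemma scott_continuous_lub:
  "scott_continuous L M f \<Longrightarrow> directed L X \<Longrightarrow> is_lub L u X \<Longrightarrow> is_lub M (f u) (f ` X)"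
  unfolding scott_continuous_def by blast

lemma scott_continuous_mono:
  assumes "partial_order L" "scott_continuous L M f" "x \<in> carrier L" "y \<in> carrier L" "x \<sqsubseteq>\<^bsub>L\<^esub> y"
  shows "f x \<sqsubseteq>\<^bsub>M\<^esub> f y"
proof -
  interpret partial_order L by fact
  have "directed L {x, y}" using assms by (auto simp: directed_def)
  moreover have "is_lub L y {x, y}" using assms by (intro is_lubI) auto
  ultimately have lub: "is_lub M (f y) (f ` {x, y})" by (rule scott_continuous_lub[OF assms(2)])
  have "f ` {x, y} \<subseteq> carrier M"
    using assms(3,4) by (simp add: scott_continuous_car[OF assms(2)])
  from is_lubD(2)[OF lub this] show ?thesis by simp
qed

lemma scott_continuous_directed:
  assumes "partial_order L" "scott_continuous L M f" "directed L X"
  shows "directed M (f ` X)"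
  unfolding directed_def
proof (intro conjI ballI)
  have Xs: "X \<subseteq> carrier L" "X \<noteq> {}" using assms(3) by (simp_all add: directed_def)
  then show "f ` X \<subseteq> carrier M" "f ` X \<noteq> {}"
    by (auto simp: scott_continuous_car[OF assms(2)])
  fix a b assume "a \<in> f ` X" "b \<in> f ` X"
  then obtain x y where xy: "x \<in> X" "y \<in> X" "a = f x" "b = f y" by blast
  then obtain z where z: "z \<in> X" "x \<sqsubseteq>\<^bsub>L\<^esub> z" "y \<sqsubseteq>\<^bsub>L\<^esub> z"
    using assms(3) unfolding directed_def by blast
  have "a \<sqsubseteq>\<^bsub>M\<^esub> f z" "b \<sqsubseteq>\<^bsub>M\<^esub> f z"
    unfolding xy(3,4) using xy(1,2) z Xs(1) by (auto intro: scott_continuous_mono[OF assms(1,2)])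
  with z show "\<exists>z\<in>f ` X. a \<sqsubseteq>\<^bsub>M\<^esub> z \<and> b \<sqsubseteq>\<^bsub>M\<^esub> z" by blast
qed

lemma scott_continuous_comp:
  assumes "partial_order L" "scott_continuous L M f" "scott_continuous M N g"
  shows "scott_continuous L N (\<lambda>x. g (f x))"
proof -
  have "is_lub N (g (f u)) ((\<lambda>x. g (f x)) ` X)" if X: "directed L X" "is_lub L u X" for X u
  proof -
    have "is_lub M (f u) (f ` X)" by (rule scott_continuous_lub[OF assms(2) X])
    then have "is_lub N (g (f u)) (g ` f ` X)"
      using scott_continuous_lub[OF assms(3) scott_continuous_directed[OF assms(1,2) X(1)]] by blast
    then show ?thesis by (simp add: image_image)
  qed
  moreover have "(\<lambda>x. g (f x)) \<in> carrier L \<rightarrow> carrier N"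
    by (simp add: scott_continuous_car[OF assms(2)] scott_continuous_car[OF assms(3)])
  ultimately show ?thesis by (simp add: scott_continuous_def)
qed

lemma fun_space_memI: "scott_continuous L L f \<Longrightarrow> fn (carrier L) f \<in> carrier (fun_space L)"
  by (auto simp: fun_space_def)

lemma fun_space_memD:
  assumes "small (carrier L)" "x \<in> carrier (fun_space L)"
  shows "scott_continuous L L (ap x)" "fn (carrier L) (ap x) = x"
proof -
  obtain f where f: "scott_continuous L L f" "x = fn (carrier L) f"
    using assms by (auto simp: fun_space_def)
  have eq: "ap x d = f d" if "d \<in> carrier L" for d
    using assms that f by (simp add: ap_fn)
  then show "fn (carrier L) (ap x) = x" using f(2) by (simp cong: fn_cong)
  show "scott_continuous L L (ap x)"
    unfolding scott_continuous_def
  proof (intro conjI allI impI)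
    show "ap x \<in> carrier L \<rightarrow> carrier L" using scott_continuous_car[OF f(1)] eq by simp
    fix X u assume X: "directed L X" "is_lub L u X"
    then have "is_lub L (f u) (f ` X)" using scott_continuous_lub[OF f(1)] by blast
    moreover have Xs: "X \<subseteq> carrier L" using X by (simp add: directed_def)
    have "ap x ` X = f ` X" using Xs eq by (intro image_cong) auto
    moreover have "ap x u = f u" using is_lubD(1)[OF X(2) Xs] eq by blast
    ultimately show "is_lub L (ap x u) (ap x ` X)" by simp
  qed
qed

lemma fun_space_le: "x \<sqsubseteq>\<^bsub>fun_space L\<^esub> y \<longleftrightarrow> (\<forall>d\<in>carrier L. ap x d \<sqsubseteq>\<^bsub>L\<^esub> ap y d)"
  by (simp add: fun_space_def)

lemma partial_orderI_eq:
  assumes "eq L = (=)" "\<And>x. x \<in> carrier L \<Longrightarrow> x \<sqsubseteq>\<^bsub>L\<^esub> x"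
    "\<And>x y. x \<sqsubseteq>\<^bsub>L\<^esub> y \<Longrightarrow> y \<sqsubseteq>\<^bsub>L\<^esub> x \<Longrightarrow> x \<in> carrier L \<Longrightarrow> y \<in> carrier L \<Longrightarrow> x = y"
    "\<And>x y z. x \<sqsubseteq>\<^bsub>L\<^esub> y \<Longrightarrow> y \<sqsubseteq>\<^bsub>L\<^esub> z \<Longrightarrow> x \<in> carrier L \<Longrightarrow> y \<in> carrier L \<Longrightarrow> z \<in> carrier L \<Longrightarrow> x \<sqsubseteq>\<^bsub>L\<^esub> z"
  shows "partial_order L"
  by unfold_locales (simp_all add: assms(1), (use assms in blast)+)

lemma fun_space_partial_order:
  assumes "partial_order L" "small (carrier L)"
  shows "partial_order (fun_space L)"
proof -
  interpret partial_order L by fact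
  have c: "ap x d \<in> carrier L" if "x \<in> carrier (fun_space L)" "d \<in> carrier L" for x d
    using scott_continuous_car[OF fun_space_memD(1)[OF assms(2) that(1)] that(2)] .
  show ?thesis
  proof (rule partial_orderI_eq)
    show "eq (fun_space L) = (=)" by (simp add: fun_space_def)
    show "x \<sqsubseteq>\<^bsub>fun_space L\<^esub> x" if "x \<in> carrier (fun_space L)" for x
      using c that by (simp add: fun_space_le)
    show "x \<sqsubseteq>\<^bsub>fun_space L\<^esub> z"
      if "x \<sqsubseteq>\<^bsub>fun_space L\<^esub> y" "y \<sqsubseteq>\<^bsub>fun_space L\<^esub> z" "x \<in> carrier (fun_space L)"
        "y \<in> carrier (fun_space L)" "z \<in> carrier (fun_space L)" for x y z
      using c that unfolding fun_space_le by (meson le_trans)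
    show "x = y"
      if "x \<sqsubseteq>\<^bsub>fun_space L\<^esub> y" "y \<sqsubseteq>\<^bsub>fun_space L\<^esub> x" "x \<in> carrier (fun_space L)"
        "y \<in> carrier (fun_space L)" for x y
    proof -
      have "ap x d = ap y d" if "d \<in> carrier L" for d
        using that c \<open>x \<in> _\<close> \<open>y \<in> _\<close> \<open>x \<sqsubseteq>\<^bsub>_\<^esub> y\<close> \<open>y \<sqsubseteq>\<^bsub>_\<^esub> x\<close>
        by (auto simp: fun_space_le intro!: le_antisym)
      then show ?thesis
        using fun_space_memD(2)[OF assms(2) \<open>x \<in> _\<close>] fun_space_memD(2)[OF assms(2) \<open>y \<in> _\<close>]
        by (metis fn_cong)
    qed
  qed
qed

lemma fun_space_directed_ap:
  assumes "small (carrier L)" "directed (fun_space L) X" "d \<in> carrier L"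
  shows "directed L ((\<lambda>x. ap x d) ` X)"
  unfolding directed_def
proof (intro conjI ballI)
  show "(\<lambda>x. ap x d) ` X \<subseteq> carrier L"
    using assms(2,3) scott_continuous_car[OF fun_space_memD(1)[OF assms(1)]]
    unfolding directed_def by blast
  show "(\<lambda>x. ap x d) ` X \<noteq> {}" using assms by (auto simp: directed_def)
  fix a b assume "a \<in> (\<lambda>x. ap x d) ` X" "b \<in> (\<lambda>x. ap x d) ` X"
  then obtain x y where xy: "x \<in> X" "y \<in> X" "a = ap x d" "b = ap y d" by blast
  then obtain z where "z \<in> X" "x \<sqsubseteq>\<^bsub>fun_space L\<^esub> z" "y \<sqsubseteq>\<^bsub>fun_space L\<^esub> z"
    using assms(2) unfolding directed_def by blast
  with xy assms(3) show "\<exists>z\<in>(\<lambda>x. ap x d) ` X. a \<sqsubseteq>\<^bsub>L\<^esub> z \<and> b \<sqsubseteq>\<^bsub>L\<^esub> z"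
    by (auto simp: fun_space_le)
qed

lemma fun_space_lub:
  assumes "cpo L" "small (carrier L)" "directed (fun_space L) X"
  shows "\<exists>u. is_lub (fun_space L) u X \<and>
    (\<forall>d\<in>carrier L. is_lub L (ap u d) ((\<lambda>x. ap x d) ` X))"
proof -
  interpret cpo L by fact
  have po: "partial_order L" by unfold_locales
  have dir: "directed L ((\<lambda>x. ap x d) ` X)" if "d \<in> carrier L" for d
    using fun_space_directed_ap[OF assms(2,3) that] .
  have sub: "(\<lambda>x. ap x d) ` X \<subseteq> carrier L" if "d \<in> carrier L" for d
    using dir[OF that] by (simp add: directed_def)
  have xcar: "ap x d \<in> carrier L" if "x \<in> X" "d \<in> carrier L" for x d
    using sub[OF that(2)] imageI[OF that(1)] by (rule subsetD)
  have cont: "scott_continuous L L (ap x)" if "x \<in> X" for x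
    using assms that fun_space_memD(1) by (auto simp: directed_def)
  have "\<forall>d\<in>carrier L. \<exists>v. is_lub L v ((\<lambda>x. ap x d) ` X)"
    using directed_lub_exists dir by blast
  then obtain f where f: "\<And>d. d \<in> carrier L \<Longrightarrow> is_lub L (f d) ((\<lambda>x. ap x d) ` X)"
    by metis
  have fc: "f d \<in> carrier L" if "d \<in> carrier L" for d
    using is_lubD(1)[OF f[OF that] sub[OF that]] .
  have fu: "ap x d \<sqsubseteq>\<^bsub>L\<^esub> f d" if "d \<in> carrier L" "x \<in> X" for x d
    by (rule is_lubD(2)[OF f[OF that(1)] sub[OF that(1)] imageI[OF that(2)]])
  have fl: "f d \<sqsubseteq>\<^bsub>L\<^esub> v" if "d \<in> carrier L" "v \<in> carrier L" "\<And>x. x \<in> X \<Longrightarrow> ap x d \<sqsubseteq>\<^bsub>L\<^esub> v" for d v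
    by (rule is_lubD(3)[OF f[OF that(1)] sub[OF that(1)] that(2)]) (use that(3) in auto)
  have sc: "scott_continuous L L f"
    unfolding scott_continuous_def
  proof (intro conjI allI impI)
    show "f \<in> carrier L \<rightarrow> carrier L" using fc by blast
    fix Y w assume Y: "directed L Y" "is_lub L w Y"
    have Ys: "Y \<subseteq> carrier L" using Y by (simp add: directed_def)
    have w: "w \<in> carrier L" using is_lubD(1)[OF Y(2) Ys] .
    have lub: "is_lub L (ap x w) (ap x ` Y)" if "x \<in> X" for x
      using scott_continuous_lub[OF cont[OF that] Y] .
    have aps: "ap x ` Y \<subseteq> carrier L" if "x \<in> X" for x
      using xcar[OF that] Ys by auto
    show "is_lub L (f w) (f ` Y)"
    proof (rule is_lubI)
      show "f w \<in> carrier L" using fc[OF w] .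
      fix a assume "a \<in> f ` Y"
      then obtain y where y: "y \<in> Y" "a = f y" by blast
      have "f y \<sqsubseteq>\<^bsub>L\<^esub> f w"
      proof (rule fl)
        show yc: "y \<in> carrier L" using y Ys by blast
        show "f w \<in> carrier L" using fc[OF w] .
        fix x assume x: "x \<in> X"
        have "ap x y \<sqsubseteq>\<^bsub>L\<^esub> ap x w" by (rule is_lubD(2)[OF lub[OF x] aps[OF x] imageI[OF y(1)]])
        then show "ap x y \<sqsubseteq>\<^bsub>L\<^esub> f w"
          by (rule le_trans) (intro fu xcar fc w x yc)+
      qed
      then show "a \<sqsubseteq>\<^bsub>L\<^esub> f w" using y by simp
    next
      fix v assume v: "v \<in> carrier L" "\<And>a. a \<in> f ` Y \<Longrightarrow> a \<in> carrier L \<Longrightarrow> a \<sqsubseteq>\<^bsub>L\<^esub> v"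
      show "f w \<sqsubseteq>\<^bsub>L\<^esub> v"
      proof (rule fl[OF w v(1)])
        fix x assume x: "x \<in> X"
        show "ap x w \<sqsubseteq>\<^bsub>L\<^esub> v"
        proof (rule is_lubD(3)[OF lub[OF x] aps[OF x] v(1)])
          fix a assume "a \<in> ap x ` Y"
          then obtain y where y: "y \<in> Y" "a = ap x y" by blast
          then have yc: "y \<in> carrier L" using Ys by blast
          have "f y \<sqsubseteq>\<^bsub>L\<^esub> v" using v(2)[OF imageI[OF y(1)] fc[OF yc]] .
          from le_trans[OF fu[OF yc x] this xcar[OF x yc] fc[OF yc] v(1)]
          show "a \<sqsubseteq>\<^bsub>L\<^esub> v" unfolding y(2) .
        qed
      qed
    qed
  qed
  define u where "u = fn (carrier L) f"
  have u: "u \<in> carrier (fun_space L)" unfolding u_def using sc by (rule fun_space_memI)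
  have apu: "ap u d = f d" if "d \<in> carrier L" for d
    using that assms(2) by (simp add: u_def ap_fn)
  show ?thesis
  proof (intro exI conjI ballI)
    show "is_lub L (ap u d) ((\<lambda>x. ap x d) ` X)" if "d \<in> carrier L" for d
      using f that apu by simp
    show "is_lub (fun_space L) u X"
    proof (rule is_lubI[OF u])
      fix x assume "x \<in> X"
      then show "x \<sqsubseteq>\<^bsub>fun_space L\<^esub> u" by (simp add: fun_space_le apu fu)
    next
      fix v assume v: "v \<in> carrier (fun_space L)"
        "\<And>x. x \<in> X \<Longrightarrow> x \<in> carrier (fun_space L) \<Longrightarrow> x \<sqsubseteq>\<^bsub>fun_space L\<^esub> v"
      have "ap v d \<in> carrier L" if "d \<in> carrier L" for d
        using scott_continuous_car[OF fun_space_memD(1)[OF assms(2) v(1)] that] .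
      moreover have "ap x d \<sqsubseteq>\<^bsub>L\<^esub> ap v d" if "d \<in> carrier L" "x \<in> X" for d x
        using v(2)[OF that(2)] that assms(3) by (auto simp: fun_space_le directed_def)
      ultimately show "u \<sqsubseteq>\<^bsub>fun_space L\<^esub> v" by (simp add: fun_space_le apu fl)
    qed
  qed
qed

lemma fun_space_cpo:
  assumes "cpo L" "small (carrier L)" shows "cpo (fun_space L)"
proof -
  interpret cpo L by fact
  interpret F: partial_order "fun_space L"
    by (rule fun_space_partial_order[OF partial_order_axioms assms(2)])
  obtain b where b: "least L b (carrier L)" using bottom_exists by blast
  then have bc: "b \<in> carrier L" and bl: "\<And>d. d \<in> carrier L \<Longrightarrow> b \<sqsubseteq>\<^bsub>L\<^esub> d"
    by (simp_all add: least_def)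
  show ?thesis
  proof
    have "scott_continuous L L (\<lambda>_. b)"
      unfolding scott_continuous_def
    proof (intro conjI allI impI)
      show "(\<lambda>_. b) \<in> carrier L \<rightarrow> carrier L" using bc by simp
      fix X u assume "directed L X"
      then have "(\<lambda>_. b) ` X = {b}" unfolding directed_def by auto
      then show "is_lub L b ((\<lambda>_. b) ` X)"
        using bc by (simp add: least_def Upper_def)
    qed
    then have "fn (carrier L) (\<lambda>_. b) \<in> carrier (fun_space L)" by (rule fun_space_memI)
    moreover have "fn (carrier L) (\<lambda>_. b) \<sqsubseteq>\<^bsub>fun_space L\<^esub> x" if "x \<in> carrier (fun_space L)" for x
      unfolding fun_space_le
      by (simp add: ap_fn[OF assms(2)] bl scott_continuous_car[OF fun_space_memD(1)[OF assms(2) that]])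
    ultimately have "least (fun_space L) (fn (carrier L) (\<lambda>_. b)) (carrier (fun_space L))"
      unfolding least_def by simp
    then show "\<exists>b. least (fun_space L) b (carrier (fun_space L))" by (rule exI)
    show "\<exists>u. is_lub (fun_space L) u X" if X: "directed (fun_space L) X" for X
      using fun_space_lub[OF assms X] by auto
  qed
qed

definition finitary_approx :: "scott gorder \<Rightarrow> (nat \<Rightarrow> scott \<Rightarrow> scott) \<Rightarrow> bool" where
  "finitary_approx L p \<longleftrightarrow>
     (\<forall>k. scott_continuous L L (p k) \<and> finite (p k ` carrier L)) \<and>
     (\<forall>d\<in>carrier L. (\<forall>k. p k d \<sqsubseteq>\<^bsub>L\<^esub> p (Suc k) d) \<and> is_lub L d (range (\<lambda>k. p k d)))"

lemma finitary_approx_small: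
  assumes "cpo L" "finitary_approx L p"
  shows "small (carrier L)"
proof -
  interpret cpo L by fact
  define B where "B = (\<Union>k. p k ` carrier L)"
  have "countable (p k ` carrier L)" for k
    using assms(2) unfolding finitary_approx_def by (intro countable_finite) blast
  then have B: "countable B" unfolding B_def by simp
  define c where "c d = range (\<lambda>k. prod_encode (k, to_nat_on B (p k d)))" for d
  have "inj_on c (carrier L)"
  proof (rule inj_onI)
    fix d e assume d: "d \<in> carrier L" and e: "e \<in> carrier L" and eq: "c d = c e"
    have "p k d = p k e" for k
    proof -
      have "prod_encode (k, to_nat_on B (p k d)) \<in> c e" using eq c_def by blast
      then have "to_nat_on B (p k d) = to_nat_on B (p k e)" by (auto simp: c_def)
      moreover have "p k d \<in> B" "p k e \<in> B" using d e by (auto simp: B_def)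
      ultimately show ?thesis using B by simp
    qed
    then have "is_lub L d (range (\<lambda>k. p k d))" "is_lub L e (range (\<lambda>k. p k d))"
      using assms(2) d e by (auto simp: finitary_approx_def)
    then show "d = e" by (rule least_unique)
  qed
  moreover have "carrier L \<noteq> {}" using bottom_exists by (auto simp: least_def)
  ultimately show ?thesis by (auto simp: small_def)
qed

lemma finitary_approx_fun_space:
  assumes "cpo L" "finitary_approx L p"
  shows "finitary_approx (fun_space L) (\<lambda>k x. fn (carrier L) (\<lambda>d. p k (ap x (p k d))))"
    (is "finitary_approx _ ?P")
proof -
  interpret cpo L by fact
  have po: "partial_order L" by unfold_locales
  have sm: "small (carrier L)" using finitary_approx_small[OF assms] .
  interpret F: cpo "fun_space L" by (rule fun_space_cpo[OF assms(1) sm])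
  have Fpo: "partial_order (fun_space L)" by unfold_locales
  have pc: "scott_continuous L L (p k)" and pf: "finite (p k ` carrier L)" for k
    using assms(2) by (auto simp: finitary_approx_def)
  have pcar: "p k d \<in> carrier L" if "d \<in> carrier L" for k d
    using scott_continuous_car[OF pc that] .
  have pm: "p k d \<sqsubseteq>\<^bsub>L\<^esub> p k e" if "d \<in> carrier L" "e \<in> carrier L" "d \<sqsubseteq>\<^bsub>L\<^esub> e" for k d e
    using scott_continuous_mono[OF po pc that] .
  have pSuc: "p k d \<sqsubseteq>\<^bsub>L\<^esub> p (Suc k) d" and plub: "is_lub L d (range (\<lambda>k. p k d))"
    if "d \<in> carrier L" for k d
    using assms(2) that by (auto simp: finitary_approx_def)
  have pchain: "p j d \<sqsubseteq>\<^bsub>L\<^esub> p k d" if "d \<in> carrier L" "j \<le> k" for j k d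
    using that(2)
  proof (induction k rule: dec_induct)
    case base show ?case using pcar that by simp
  next
    case (step k)
    show ?case by (rule le_trans[OF step.IH pSuc]) (intro pcar that(1))+
  qed
  have rng: "range (\<lambda>k. p k d) \<subseteq> carrier L" if "d \<in> carrier L" for d
    using pcar[OF that] by auto
  have ple: "p k d \<sqsubseteq>\<^bsub>L\<^esub> d" if "d \<in> carrier L" for k d
    by (rule is_lubD(2)[OF plub[OF that] rng[OF that] rangeI])
  have pdir: "directed L (range (\<lambda>k. p k d))" if "d \<in> carrier L" for d
    unfolding directed_def
  proof (intro conjI ballI)
    show "range (\<lambda>k. p k d) \<subseteq> carrier L" using rng that .
    fix x y assume "x \<in> range (\<lambda>k. p k d)" "y \<in> range (\<lambda>k. p k d)"
    then obtain i j where "x = p i d" "y = p j d" by blast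
    then have "x \<sqsubseteq>\<^bsub>L\<^esub> p (max i j) d" "y \<sqsubseteq>\<^bsub>L\<^esub> p (max i j) d" by (simp_all add: pchain[OF that])
    then show "\<exists>z\<in>range (\<lambda>k. p k d). x \<sqsubseteq>\<^bsub>L\<^esub> z \<and> y \<sqsubseteq>\<^bsub>L\<^esub> z" by blast
  qed simp
  have xc: "scott_continuous L L (ap x)" if "x \<in> carrier (fun_space L)" for x
    using fun_space_memD(1)[OF sm that] .
  have xcar: "ap x d \<in> carrier L" if "x \<in> carrier (fun_space L)" "d \<in> carrier L" for x d
    using scott_continuous_car[OF xc[OF that(1)] that(2)] .
  have xm: "ap x d \<sqsubseteq>\<^bsub>L\<^esub> ap x e"
    if "x \<in> carrier (fun_space L)" "d \<in> carrier L" "e \<in> carrier L" "d \<sqsubseteq>\<^bsub>L\<^esub> e" for x d e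
    using scott_continuous_mono[OF po xc[OF that(1)] that(2-4)] .
  have Pap: "ap (?P k x) d = p k (ap x (p k d))" if "d \<in> carrier L" for k x d
    using ap_fn[OF sm that] .
  have Pcar: "?P k x \<in> carrier (fun_space L)" if "x \<in> carrier (fun_space L)" for k x
    using scott_continuous_comp[OF po scott_continuous_comp[OF po pc xc[OF that]] pc]
    by (rule fun_space_memI)
  have eqI: "x = y" if "x \<in> carrier (fun_space L)" "y \<in> carrier (fun_space L)"
    "\<And>d. d \<in> carrier L \<Longrightarrow> ap x d = ap y d" for x y
    using fun_space_memD(2)[OF sm that(1)] fun_space_memD(2)[OF sm that(2)] that(3)
    by (metis fn_cong)
  have Pcont: "scott_continuous (fun_space L) (fun_space L) (?P k)" for k
    unfolding scott_continuous_def
  proof (intro conjI allI impI)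
    show "?P k \<in> carrier (fun_space L) \<rightarrow> carrier (fun_space L)" using Pcar by auto
    fix X u assume X: "directed (fun_space L) X" and u: "is_lub (fun_space L) u X"
    have Xs: "X \<subseteq> carrier (fun_space L)" using X by (simp add: directed_def)
    obtain u' where u': "is_lub (fun_space L) u' X"
      and l': "\<forall>d\<in>carrier L. is_lub L (ap u' d) ((\<lambda>x. ap x d) ` X)"
      using fun_space_lub[OF assms(1) sm X] by auto
    have "u' = u" using u u' by (rule F.least_unique[rotated])
    note l = bspec[OF l'[unfolded this]]
    have uc: "u \<in> carrier (fun_space L)" using is_lubD(1)[OF u Xs] .
    have pl: "is_lub L (ap (?P k u) d) ((\<lambda>x. ap (?P k x) d) ` X)" if d: "d \<in> carrier L" for d
    proof -
      have "is_lub L (p k (ap u (p k d))) (p k ` (\<lambda>x. ap x (p k d)) ` X)"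
        using scott_continuous_lub[OF pc fun_space_directed_ap[OF sm X pcar[OF d]] l[OF pcar[OF d]]] .
      then show ?thesis using d by (simp add: Pap image_image)
    qed
    show "is_lub (fun_space L) (?P k u) (?P k ` X)"
    proof (rule is_lubI)
      show "?P k u \<in> carrier (fun_space L)" using Pcar[OF uc] .
      fix a assume "a \<in> ?P k ` X"
      then obtain x where x: "x \<in> X" "a = ?P k x" by blast
      show "a \<sqsubseteq>\<^bsub>fun_space L\<^esub> ?P k u"
        unfolding fun_space_le
      proof
        fix d assume d: "d \<in> carrier L"
        have "(\<lambda>x. ap (?P k x) d) ` X \<subseteq> carrier L" using Xs by (auto intro!: xcar Pcar d)
        from is_lubD(2)[OF pl[OF d] this imageI[OF x(1)]]
        show "ap a d \<sqsubseteq>\<^bsub>L\<^esub> ap (?P k u) d" unfolding x(2) .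
      qed
    next
      fix v assume v: "v \<in> carrier (fun_space L)"
        "\<And>a. a \<in> ?P k ` X \<Longrightarrow> a \<in> carrier (fun_space L) \<Longrightarrow> a \<sqsubseteq>\<^bsub>fun_space L\<^esub> v"
      show "?P k u \<sqsubseteq>\<^bsub>fun_space L\<^esub> v"
        unfolding fun_space_le
      proof
        fix d assume d: "d \<in> carrier L"
        have s: "(\<lambda>x. ap (?P k x) d) ` X \<subseteq> carrier L" using Xs by (auto intro!: xcar Pcar d)
        show "ap (?P k u) d \<sqsubseteq>\<^bsub>L\<^esub> ap v d"
        proof (rule is_lubD(3)[OF pl[OF d] s xcar[OF v(1) d]])
          fix a assume "a \<in> (\<lambda>x. ap (?P k x) d) ` X"
          then obtain x where x: "x \<in> X" "a = ap (?P k x) d" by blast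
          have "?P k x \<sqsubseteq>\<^bsub>fun_space L\<^esub> v"
            by (rule v(2)[OF imageI[OF x(1)] Pcar[OF subsetD[OF Xs x(1)]]])
          then show "a \<sqsubseteq>\<^bsub>L\<^esub> ap v d" unfolding x(2) fun_space_le using d by (rule bspec)
        qed
      qed
    qed
  qed
  have Pfin: "finite (?P k ` carrier (fun_space L))" for k
  proof -
    let ?B = "p k ` carrier L"
    have "?P k ` carrier (fun_space L)
        \<subseteq> (\<lambda>h. fn (carrier L) (\<lambda>d. h (p k d))) ` (?B \<rightarrow>\<^sub>E ?B)"
    proof
      fix a assume "a \<in> ?P k ` carrier (fun_space L)"
      then obtain x where x: "x \<in> carrier (fun_space L)" "a = ?P k x" by blast
      let ?h = "restrict (\<lambda>b. p k (ap x b)) ?B"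
      have "?h \<in> ?B \<rightarrow>\<^sub>E ?B" using xcar[OF x(1)] pcar by auto
      moreover have "a = fn (carrier L) (\<lambda>d. ?h (p k d))" unfolding x(2) by (rule fn_cong) simp
      ultimately show "a \<in> (\<lambda>h. fn (carrier L) (\<lambda>d. h (p k d))) ` (?B \<rightarrow>\<^sub>E ?B)" by blast
    qed
    then show ?thesis by (rule finite_subset) (intro finite_imageI finite_PiE pf)
  qed
  have Pchain: "?P k x \<sqsubseteq>\<^bsub>fun_space L\<^esub> ?P (Suc k) x" if x: "x \<in> carrier (fun_space L)" for k x
    unfolding fun_space_le
  proof
    fix d assume d: "d \<in> carrier L"
    have "p k (ap x (p k d)) \<sqsubseteq>\<^bsub>L\<^esub> p k (ap x (p (Suc k) d))"
      by (intro pm xm xcar pcar pSuc x d)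
    moreover have "\<dots> \<sqsubseteq>\<^bsub>L\<^esub> p (Suc k) (ap x (p (Suc k) d))"
      by (intro pSuc xcar pcar x d)
    ultimately show "ap (?P k x) d \<sqsubseteq>\<^bsub>L\<^esub> ap (?P (Suc k) x) d"
      unfolding Pap[OF d] by (rule le_trans) (intro pcar xcar x d)+
  qed
  have Plub: "is_lub (fun_space L) x (range (\<lambda>k. ?P k x))" if x: "x \<in> carrier (fun_space L)" for x
  proof (rule is_lubI[OF x])
    fix a assume "a \<in> range (\<lambda>k. ?P k x)"
    then obtain k where a: "a = ?P k x" by blast
    show "a \<sqsubseteq>\<^bsub>fun_space L\<^esub> x"
      unfolding fun_space_le a
    proof
      fix d assume d: "d \<in> carrier L"
      have "p k (ap x (p k d)) \<sqsubseteq>\<^bsub>L\<^esub> ap x (p k d)" by (intro ple xcar pcar x d)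
      moreover have "\<dots> \<sqsubseteq>\<^bsub>L\<^esub> ap x d" by (intro xm ple pcar x d)
      ultimately show "ap (?P k x) d \<sqsubseteq>\<^bsub>L\<^esub> ap x d"
        unfolding Pap[OF d] by (rule le_trans) (intro pcar xcar x d)+
    qed
  next
    fix v assume v: "v \<in> carrier (fun_space L)"
      "\<And>a. a \<in> range (\<lambda>k. ?P k x) \<Longrightarrow> a \<in> carrier (fun_space L) \<Longrightarrow> a \<sqsubseteq>\<^bsub>fun_space L\<^esub> v"
    show "x \<sqsubseteq>\<^bsub>fun_space L\<^esub> v"
      unfolding fun_space_le
    proof
      fix d assume d: "d \<in> carrier L"
      have vd: "ap v d \<in> carrier L" using xcar[OF v(1) d] .
      have bound: "p k (ap x (p k d)) \<sqsubseteq>\<^bsub>L\<^esub> ap v d" for k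
        using v(2)[OF rangeI Pcar[OF x], of k] d unfolding fun_space_le by (simp add: Pap)
      have "p j (ap x (p k d)) \<sqsubseteq>\<^bsub>L\<^esub> ap v d" for j k
      proof -
        let ?m = "max j k"
        have "p j (ap x (p k d)) \<sqsubseteq>\<^bsub>L\<^esub> p j (ap x (p ?m d))"
          by (intro pm xm xcar pcar pchain x d) simp
        moreover have "\<dots> \<sqsubseteq>\<^bsub>L\<^esub> p ?m (ap x (p ?m d))" by (intro pchain xcar pcar x d) simp
        ultimately have "p j (ap x (p k d)) \<sqsubseteq>\<^bsub>L\<^esub> p ?m (ap x (p ?m d))"
          by (rule le_trans) (intro pcar xcar x d)+
        then show ?thesis by (rule le_trans[OF _ bound]) (intro pcar xcar x d v)+
      qed
      then have *: "ap x (p k d) \<sqsubseteq>\<^bsub>L\<^esub> ap v d" for k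
        by (intro is_lubD(3)[OF plub[OF xcar[OF x pcar[OF d]]] rng[OF xcar[OF x pcar[OF d]]] vd]) auto
      have "is_lub L (ap x d) (ap x ` range (\<lambda>k. p k d))"
        using scott_continuous_lub[OF xc[OF x] pdir[OF d] plub[OF d]] .
      moreover have "ap x ` range (\<lambda>k. p k d) \<subseteq> carrier L" by (auto intro!: xcar x pcar d)
      ultimately show "ap x d \<sqsubseteq>\<^bsub>L\<^esub> ap v d" by (rule is_lubD(3)[OF _ _ vd]) (use * in auto)
    qed
  qed
  show ?thesis unfolding finitary_approx_def using Pcont Pfin Pchain Plub by simp
qed

lemma flat_nat_cpo: "cpo flat_nat"
proof -
  interpret partial_order flat_nat
    by (rule partial_orderI_eq) (auto simp: flat_nat_def)
  show ?thesis
  proof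
    show "\<exists>b. least flat_nat b (carrier flat_nat)"
      by (rule exI[of _ Bot]) (auto simp: least_def flat_nat_def)
    fix X assume X: "directed flat_nat X"
    show "\<exists>u. is_lub flat_nat u X"
    proof (cases "X \<subseteq> {Bot}")
      case True
      then show ?thesis by (intro exI[of _ Bot] is_lubI) (auto simp: flat_nat_def)
    next
      case False
      then obtain m where m: "m \<in> X" "m \<noteq> Bot" by blast
      have mx: "x \<sqsubseteq>\<^bsub>flat_nat\<^esub> m" if x: "x \<in> X" for x
      proof -
        obtain z where "z \<in> X" "x \<sqsubseteq>\<^bsub>flat_nat\<^esub> z" "m \<sqsubseteq>\<^bsub>flat_nat\<^esub> z"
          using X x m unfolding directed_def by blast
        then show ?thesis using m by (auto simp: flat_nat_def)
      qed
      have "m \<in> carrier flat_nat" using X m by (auto simp: directed_def)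
      then show ?thesis using m mx by (intro exI[of _ m] is_lubI) auto
    qed
  qed
qed

lemma flat_nat_approx:
  "finitary_approx flat_nat (\<lambda>k d. if d \<in> Num ` {..<k} then d else Bot)"
    (is "finitary_approx _ ?p")
proof -
  have cont: "scott_continuous flat_nat flat_nat (?p k)" for k
    unfolding scott_continuous_def
  proof (intro conjI allI impI)
    show "?p k \<in> carrier flat_nat \<rightarrow> carrier flat_nat" by (auto simp: flat_nat_def)
    fix X u assume X: "directed flat_nat X" and u: "is_lub flat_nat u X"
    have Xs: "X \<subseteq> carrier flat_nat" using X by (simp add: directed_def)
    have uX: "u \<in> X"
    proof (rule ccontr)
      assume nu: "u \<notin> X"
      have "x \<sqsubseteq>\<^bsub>flat_nat\<^esub> Bot" if "x \<in> X" for x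
        using is_lubD(2)[OF u Xs that] nu that by (auto simp: flat_nat_def)
      then have "u \<sqsubseteq>\<^bsub>flat_nat\<^esub> Bot" using is_lubD(3)[OF u Xs, of Bot] by (auto simp: flat_nat_def)
      moreover obtain x where "x \<in> X" using X by (auto simp: directed_def)
      ultimately show False
        using \<open>\<And>x. x \<in> X \<Longrightarrow> x \<sqsubseteq>\<^bsub>flat_nat\<^esub> Bot\<close>[of x] nu by (auto simp: flat_nat_def)
    qed
    show "is_lub flat_nat (?p k u) (?p k ` X)"
    proof (rule is_lubI)
      show "?p k u \<in> carrier flat_nat" by (auto simp: flat_nat_def)
      show "a \<sqsubseteq>\<^bsub>flat_nat\<^esub> ?p k u" if "a \<in> ?p k ` X" for a
        using that is_lubD(2)[OF u Xs] by (fastforce simp: flat_nat_def)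
      show "?p k u \<sqsubseteq>\<^bsub>flat_nat\<^esub> v"
        if "\<And>x. x \<in> ?p k ` X \<Longrightarrow> x \<in> carrier flat_nat \<Longrightarrow> x \<sqsubseteq>\<^bsub>flat_nat\<^esub> v" for v
        using that uX by (auto simp: flat_nat_def)
    qed
  qed
  have fin: "finite (?p k ` carrier flat_nat)" for k
    by (rule finite_subset[of _ "insert Bot (Num ` {..<k})"]) auto
  have lub: "is_lub flat_nat d (range (\<lambda>k. ?p k d))" if d: "d \<in> carrier flat_nat" for d
  proof (rule is_lubI[OF d])
    show "a \<sqsubseteq>\<^bsub>flat_nat\<^esub> d" if "a \<in> range (\<lambda>k. ?p k d)" for a
      using that by (auto simp: flat_nat_def)
    fix v assume v: "\<And>a. a \<in> range (\<lambda>k. ?p k d) \<Longrightarrow> a \<in> carrier flat_nat \<Longrightarrow> a \<sqsubseteq>\<^bsub>flat_nat\<^esub> v"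
    show "d \<sqsubseteq>\<^bsub>flat_nat\<^esub> v"
    proof (cases d)
      case (Num m)
      then have "d = ?p (Suc m) d" by simp
      then show ?thesis using v d by blast
    qed (use d in \<open>auto simp: flat_nat_def\<close>)
  qed
  show ?thesis
    unfolding finitary_approx_def using cont fin lub by (auto simp: flat_nat_def)
qed

lemma D_approx: "cpo (D n) \<and> (\<exists>p. finitary_approx (D n) p)"
proof (induction n)
  case 0
  show ?case using flat_nat_cpo flat_nat_approx by auto
next
  case (Suc n)
  then obtain p where p: "cpo (D n)" "finitary_approx (D n) p" by blast
  from finitary_approx_small[OF p] finitary_approx_fun_space[OF p] fun_space_cpo[OF p(1)]
  show ?case by auto
qed

lemma D_cpo: "cpo (D n)"
  using D_approx by blast

lemma D_small: "small (carrier (D n))"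
  using D_approx finitary_approx_small by blast

lemma D_Suc_bij:
  "bij_betw (\<lambda>x. restrict (ap x) (carrier (D n))) (carrier (D (Suc n)))
     {f \<in> extensional (carrier (D n)). scott_continuous (D n) (D n) f}"
proof -
  let ?A = "carrier (D n)"
  have po: "partial_order (D n)" using D_cpo[of n] by (simp add: cpo_def)
  have res: "scott_continuous (D n) (D n) (restrict f ?A)"
    if f: "scott_continuous (D n) (D n) f" for f
    unfolding scott_continuous_def
  proof (intro conjI allI impI)
    show "restrict f ?A \<in> ?A \<rightarrow> ?A" using scott_continuous_car[OF f] by simp
    fix X u assume X: "directed (D n) X" "is_lub (D n) u X"
    have Xs: "X \<subseteq> ?A" using X by (simp add: directed_def)
    with is_lubD(1)[OF X(2) Xs] have "restrict f ?A ` X = f ` X" "restrict f ?A u = f u" by (auto intro!: image_cong)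
    then show "is_lub (D n) (restrict f ?A u) (restrict f ?A ` X)"
      using scott_continuous_lub[OF f X] by simp
  qed
  show ?thesis
  proof (rule bij_betw_byWitness[where f' = "fn ?A"])
    show "\<forall>x\<in>carrier (D (Suc n)). fn ?A (restrict (ap x) ?A) = x"
      using fun_space_memD(2)[OF D_small[of n]] by (auto cong: fn_cong)
    show "\<forall>f\<in>{f \<in> extensional ?A. scott_continuous (D n) (D n) f}.
        restrict (ap (fn ?A f)) ?A = f"
      by (auto simp: ap_fn[OF D_small] restrict_def extensional_def fun_eq_iff)
    show "(\<lambda>x. restrict (ap x) ?A) ` carrier (D (Suc n))
        \<subseteq> {f \<in> extensional ?A. scott_continuous (D n) (D n) f}"
      using fun_space_memD(1)[OF D_small[of n]] res by auto
    show "fn ?A ` {f \<in> extensional ?A. scott_continuous (D n) (D n) f} \<subseteq> carrier (D (Suc n))"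
      using fun_space_memI by auto
  qed
qed

section \<open>Scott's \<open>D\<^sub>\<infinity>\<close>\<close>

fun phi :: "nat \<Rightarrow> scott \<Rightarrow> scott" and psi :: "nat \<Rightarrow> scott \<Rightarrow> scott" where
  "phi 0 = (\<lambda>d. fn (carrier (D 0)) (\<lambda>_. d))"
| "phi (Suc n) = (\<lambda>d. fn (carrier (D (Suc n))) (phi n \<circ> ap d \<circ> psi n))"
| "psi 0 = (\<lambda>g. ap g \<bottom>\<^bsub>D 0\<^esub>)"
| "psi (Suc n) = (\<lambda>g. fn (carrier (D n)) (psi n \<circ> ap g \<circ> phi n))"

definition D_inf :: "(nat \<Rightarrow> scott) gorder" where
  "D_inf = \<lparr>carrier = {d. \<forall>n. d n \<in> carrier (D n) \<and> psi n (d (Suc n)) = d n},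
     eq = (=), le = (\<lambda>d e. \<forall>n. d n \<sqsubseteq>\<^bsub>D n\<^esub> e n)\<rparr>"

text \<open>
  \<open>foldr psi [m..<n]\<close> is \<open>\<psi>\<^sub>m \<circ> \<dots> \<circ> \<psi>\<^sub>n\<^sub>-\<^sub>1\<close> and \<open>fold phi [n..<m]\<close> is \<open>\<phi>\<^sub>m\<^sub>-\<^sub>1 \<circ> \<dots> \<circ> \<phi>\<^sub>n\<close>,
  the identity for \<open>m = n\<close>.
\<close>

definition phi_inf :: "nat \<Rightarrow> scott \<Rightarrow> nat \<Rightarrow> scott" where
  "phi_inf n x = (\<lambda>m. if m < n then foldr psi [m..<n] x else fold phi [n..<m] x)"

definition app_inf :: "(nat \<Rightarrow> scott) \<Rightarrow> (nat \<Rightarrow> scott) \<Rightarrow> nat \<Rightarrow> scott" where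
  "app_inf a b = \<Squnion>\<^bsub>D_inf\<^esub> (range (\<lambda>n. phi_inf n (ap (a (Suc n)) (b n))))"

section \<open>Homotopy classes of maps of cubes\<close>

text \<open>
  Points of the \<open>n\<close>-cube are functions on \<^term>\<open>{..<n}\<close>, and maps on the cube are \<^const>\<open>undefined\<close>
  outside it, so that equality of homotopy classes and of \<open>\<pi>\<^sub>n\<close> is literal equality of sets. Since
  all maps in \<open>\<pi>\<^sub>n(X, d)\<close> send the boundary to \<open>d\<close>, the set determines \<open>d\<close> (lemma \<open>hpi_inj\<close>).
\<close>

definition cube :: "nat \<Rightarrow> (nat \<Rightarrow> real) topology" where
  "cube n = product_topology (\<lambda>_. top_of_set {0..1}) {..<n}"

definition cube_boundary :: "nat \<Rightarrow> (nat \<Rightarrow> real) set" where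
  "cube_boundary n = {x \<in> topspace (cube n). \<exists>i<n. x i = 0 \<or> x i = 1}"

definition sphere_maps :: "'a topology \<Rightarrow> nat \<Rightarrow> 'a \<Rightarrow> ((nat \<Rightarrow> real) \<Rightarrow> 'a) set" where
  "sphere_maps X n d = {f \<in> extensional (topspace (cube n)).
     continuous_map (cube n) X f \<and> (\<forall>x\<in>cube_boundary n. f x = d)}"

definition homotopy_rel ::
    "'a topology \<Rightarrow> nat \<Rightarrow> 'a \<Rightarrow> (((nat \<Rightarrow> real) \<Rightarrow> 'a) \<times> ((nat \<Rightarrow> real) \<Rightarrow> 'a)) set" where
  "homotopy_rel X n d = {(f, g). f \<in> sphere_maps X n d \<and> g \<in> sphere_maps X n d \<and>
     homotopic_with (\<lambda>h. \<forall>x\<in>cube_boundary n. h x = d) (cube n) X f g}"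

datatype 'a hset = Point 'a | Classes "((nat \<Rightarrow> real) \<Rightarrow> 'a) set set"

definition hpi :: "'a topology \<Rightarrow> nat \<Rightarrow> 'a \<Rightarrow> 'a hset" where
  "hpi X n d = (if n = 0 then Point d else Classes (sphere_maps X n d // homotopy_rel X n d))"

lemma hpi_inj:
  assumes "d \<in> topspace X" "d' \<in> topspace X"
  shows "hpi X n d = hpi X n d' \<longleftrightarrow> d = d'"
proof (cases "n = 0")
  case False
  define z :: "nat \<Rightarrow> real" where "z = restrict (\<lambda>_. 0) {..<n}"
  have z: "z \<in> cube_boundary n"
    using False by (auto simp: z_def cube_boundary_def cube_def intro!: exI[of _ 0])
  define f where "f = restrict (\<lambda>_. d) (topspace (cube n))"
  have "continuous_map (cube n) X f"
    using assms(1) by (auto simp: f_def intro: continuous_map_eq[of _ _ "\<lambda>_. d"])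
  then have f: "f \<in> sphere_maps X n d"
    by (auto simp: sphere_maps_def f_def cube_boundary_def)
  then have ff: "(f, f) \<in> homotopy_rel X n d"
    by (auto simp: homotopy_rel_def sphere_maps_def)
  have "d = d'" if "hpi X n d = hpi X n d'"
  proof -
    have "homotopy_rel X n d `` {f} \<in> sphere_maps X n d' // homotopy_rel X n d'"
      using that False f by (auto simp: hpi_def intro: quotientI)
    then obtain g where "homotopy_rel X n d `` {f} = homotopy_rel X n d' `` {g}"
      by (auto elim: quotientE)
    with ff have "f \<in> sphere_maps X n d'" by (auto simp: homotopy_rel_def)
    with f z show "d = d'" by (auto simp: sphere_maps_def)
  qed
  then show ?thesis by blast
qed (simp add: hpi_def)

section \<open>The structure \<open>\<DD>\<^sub>\<infinity>\<close>\<close>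

abbreviation D_inf_top :: "(nat \<Rightarrow> scott) topology" where
  "D_inf_top \<equiv> scott_topology D_inf"

definition DD :: "nat \<Rightarrow> (nat \<Rightarrow> scott) hset set" where
  "DD n = hpi D_inf_top n ` carrier D_inf"

text \<open>The base point of an element of \<^term>\<open>DD n\<close>; it is unique by \<open>hpi_inj\<close>.\<close>

definition base :: "nat \<Rightarrow> (nat \<Rightarrow> scott) hset \<Rightarrow> nat \<Rightarrow> scott" where
  "base n x = (THE d. d \<in> carrier D_inf \<and> x = hpi D_inf_top n d)"

text \<open>\<open>DD_src n\<close> and \<open>DD_tgt n\<close> are the maps \<open>s\<close> and \<open>t\<close> from \<^term>\<open>DD (Suc n)\<close> to \<^term>\<open>DD n\<close>.\<close>

definition DD_src :: "nat \<Rightarrow> (nat \<Rightarrow> scott) hset \<Rightarrow> (nat \<Rightarrow> scott) hset" where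
  "DD_src n x = hpi D_inf_top n (base (Suc n) x)"

definition DD_tgt :: "nat \<Rightarrow> (nat \<Rightarrow> scott) hset \<Rightarrow> (nat \<Rightarrow> scott) hset" where
  "DD_tgt n x = hpi D_inf_top n (base (Suc n) x)"

definition DD_inf :: "(nat \<Rightarrow> (nat \<Rightarrow> scott) hset) set" where
  "DD_inf = {x. \<forall>n. x n \<in> DD n \<and> DD_src n (x (Suc n)) = x n \<and> DD_tgt n (x (Suc n)) = x n}"

definition DD_app ::
    "nat \<Rightarrow> (nat \<Rightarrow> scott) hset \<Rightarrow> (nat \<Rightarrow> scott) hset \<Rightarrow> (nat \<Rightarrow> scott) hset" where
  "DD_app n x y = hpi D_inf_top n (app_inf (base n x) (base n y))"

definition DD_inf_app ::
    "(nat \<Rightarrow> (nat \<Rightarrow> scott) hset) \<Rightarrow> (nat \<Rightarrow> (nat \<Rightarrow> scott) hset) \<Rightarrow> nat \<Rightarrow> (nat \<Rightarrow> scott) hset" where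
  "DD_inf_app a b = (\<lambda>n. DD_app n (a n) (b n))"

lemma topspace_scott_topology: "topspace (scott_topology L) = carrier L"
proof -
  have "scott_open L (carrier L)"
    by (auto simp: scott_open_def directed_def)
  then show ?thesis
    unfolding topspace_def openin_scott_topology by (auto simp: scott_open_def)
qed

lemma base_hpi: "d \<in> carrier D_inf \<Longrightarrow> base n (hpi D_inf_top n d) = d"
  unfolding base_def by (rule the_equality) (auto simp: hpi_inj topspace_scott_topology)

lemma DD_src_hpi: "d \<in> carrier D_inf \<Longrightarrow> DD_src n (hpi D_inf_top (Suc n) d) = hpi D_inf_top n d"
  by (simp add: DD_src_def base_hpi)

lemma DD_tgt_hpi: "d \<in> carrier D_inf \<Longrightarrow> DD_tgt n (hpi D_inf_top (Suc n) d) = hpi D_inf_top n d"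
  by (simp add: DD_tgt_def base_hpi)

lemma DD_app_hpi:
  "a \<in> carrier D_inf \<Longrightarrow> b \<in> carrier D_inf \<Longrightarrow>
    DD_app n (hpi D_inf_top n a) (hpi D_inf_top n b) = hpi D_inf_top n (app_inf a b)"
  by (simp add: DD_app_def base_hpi)

section \<open>Applicative structures and \<open>\<lambda>\<close>-models\<close>

definition applicative_structure :: "'a set \<Rightarrow> ('a \<Rightarrow> 'a \<Rightarrow> 'a) \<Rightarrow> bool" where
  "applicative_structure A f \<longleftrightarrow> (\<forall>a\<in>A. \<forall>b\<in>A. f a b \<in> A)"

definition applicative_iso ::
    "'a set \<Rightarrow> ('a \<Rightarrow> 'a \<Rightarrow> 'a) \<Rightarrow> 'b set \<Rightarrow> ('b \<Rightarrow> 'b \<Rightarrow> 'b) \<Rightarrow> ('a \<Rightarrow> 'b) \<Rightarrow> bool" where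
  "applicative_iso A f B g h \<longleftrightarrow> applicative_structure A f \<and> applicative_structure B g \<and>
     bij_betw h A B \<and> (\<forall>a\<in>A. \<forall>b\<in>A. h (f a b) = g (h a) (h b))"

datatype lterm = Var nat | App lterm lterm | Lam nat lterm

primrec FV :: "lterm \<Rightarrow> nat set" where
  "FV (Var x) = {x}"
| "FV (App P Q) = FV P \<union> FV Q"
| "FV (Lam x P) = FV P - {x}"

text \<open>
  Simultaneous capture-avoiding substitution; a bound variable is renamed only where it would
  capture a variable.
\<close>

primrec psubst :: "lterm \<Rightarrow> (nat \<Rightarrow> lterm) \<Rightarrow> lterm" where
  "psubst (Var x) s = s x"
| "psubst (App P Q) s = App (psubst P s) (psubst Q s)"
| "psubst (Lam x P) s =
     (let V = (\<Union>v\<in>FV P - {x}. FV (s v));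
          z = (if x \<in> V then LEAST z. z \<notin> V else x)
      in Lam z (psubst P (s(x := Var z))))"

definition subst :: "lterm \<Rightarrow> nat \<Rightarrow> lterm \<Rightarrow> lterm" (\<open>[_'/_]_\<close> [0, 0, 91] 90) where
  "[N/x]M = psubst M (Var(x := N))"

locale lambda_model =
  fixes D :: "'a set"
    and app :: "'a \<Rightarrow> 'a \<Rightarrow> 'a"  (infixl \<open>\<bullet>\<close> 70)
    and interp :: "lterm \<Rightarrow> (nat \<Rightarrow> 'a) \<Rightarrow> 'a"
  assumes two_elements: "\<exists>a\<in>D. \<exists>b\<in>D. a \<noteq> b"
    and app_closed: "applicative_structure D (\<bullet>)"
    and interp_closed: "range \<rho> \<subseteq> D \<Longrightarrow> interp M \<rho> \<in> D"
    and interp_Var: "range \<rho> \<subseteq> D \<Longrightarrow> interp (Var x) \<rho> = \<rho> x"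
    and interp_App: "range \<rho> \<subseteq> D \<Longrightarrow> interp (App P Q) \<rho> = interp P \<rho> \<bullet> interp Q \<rho>"
    and interp_Lam: "range \<rho> \<subseteq> D \<Longrightarrow> d \<in> D \<Longrightarrow>
          interp (Lam x P) \<rho> \<bullet> d = interp P (\<rho>(x := d))"
    and interp_FV: "range \<rho> \<subseteq> D \<Longrightarrow> range \<sigma> \<subseteq> D \<Longrightarrow> (\<And>x. x \<in> FV M \<Longrightarrow> \<rho> x = \<sigma> x) \<Longrightarrow>
          interp M \<rho> = interp M \<sigma>"
    and interp_alpha: "range \<rho> \<subseteq> D \<Longrightarrow> y \<notin> FV M \<Longrightarrow>
          interp (Lam x M) \<rho> = interp (Lam y ([Var y/x]M)) \<rho>"
    and interp_xi: "range \<rho> \<subseteq> D \<Longrightarrow>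
          (\<And>d. d \<in> D \<Longrightarrow> interp P (\<rho>(x := d)) = interp Q (\<rho>(x := d))) \<Longrightarrow>
          interp (Lam x P) \<rho> = interp (Lam x Q) \<rho>"

locale extensional_lambda_model = lambda_model +
  assumes interp_eta: "range \<rho> \<subseteq> D \<Longrightarrow> x \<notin> FV M \<Longrightarrow>
          interp (Lam x (App M (Var x))) \<rho> = interp M \<rho>"

end

theory Submission
  imports Defs
begin

text \<open>
  Each pair \<open>\<phi>\<^sub>n\<close>, \<open>\<psi>\<^sub>n\<close> is an embedding-projection pair, so every \<open>a \<in> D\<^sub>\<infinity>\<close> is the least upper
  bound of the chain \<open>\<phi>\<^sub>n\<^sub>,\<^sub>\<infinity>(a\<^sub>n)\<close>. Application is therefore continuous in each argument, it
  satisfies \<open>(a \<bullet> \<phi>\<^sub>n\<^sub>,\<^sub>\<infinity>(x))\<^sub>n = a\<^sub>n\<^sub>+\<^sub>1(x)\<close>, whence elements are determined by their applicative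
  behaviour, and every continuous \<open>f\<close> on \<open>D\<^sub>\<infinity>\<close> is represented by the element whose component
  \<open>n + 1\<close> is \<open>x \<mapsto> f(\<phi>\<^sub>n\<^sub>,\<^sub>\<infinity>(x))\<^sub>n\<close>. Interpreting abstraction by this representation makes
  \<open>D\<^sub>\<infinity>\<close> an extensional \<open>\<lambda>\<close>-model. The homotopy sets only record their base point, hence
  \<open>d \<mapsto> \<langle>\<pi>\<^sub>n(D\<^sub>\<infinity>, d)\<rangle>\<^sub>n\<close> is an isomorphism, along which the model is transported.
\<close>

section \<open>Scott continuity\<close>

lemma is_lub_unique:
  assumes "partial_order L" "is_lub L u X" "is_lub L v X"
  shows "u = v"
proof -
  interpret partial_order L by fact
  show ?thesis using assms(2,3) by (rule least_unique)
qed

lemma directed_subset: "directed L X \<Longrightarrow> X \<subseteq> carrier L"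
  by (simp add: directed_def)

lemma scott_continuousI:
  assumes "\<And>x. x \<in> carrier L \<Longrightarrow> f x \<in> carrier M"
    and "\<And>X u. directed L X \<Longrightarrow> is_lub L u X \<Longrightarrow> u \<in> carrier L \<Longrightarrow> is_lub M (f u) (f ` X)"
  shows "scott_continuous L M f"
  unfolding scott_continuous_def using assms is_lubD(1)[OF _ directed_subset] by blast

lemma scott_continuous_cong:
  assumes "scott_continuous L M f" "\<And>x. x \<in> carrier L \<Longrightarrow> f x = g x"
  shows "scott_continuous L M g"
proof (rule scott_continuousI)
  show "g x \<in> carrier M" if "x \<in> carrier L" for x
    using scott_continuous_car[OF assms(1) that] assms(2)[OF that] by simp
  fix X u assume X: "directed L X" "is_lub L u X" "u \<in> carrier L"
  have "f ` X = g ` X" using directed_subset[OF X(1)] assms(2) by (intro image_cong) auto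
  then show "is_lub M (g u) (g ` X)"
    using scott_continuous_lub[OF assms(1) X(1,2)] assms(2)[OF X(3)] by simp
qed

lemma scott_continuous_const:
  assumes "partial_order M" "c \<in> carrier M"
  shows "scott_continuous L M (\<lambda>_. c)"
proof (rule scott_continuousI)
  interpret partial_order M by fact
  fix X u assume "directed L X"
  then have "(\<lambda>_. c) ` X = {c}" unfolding directed_def by auto
  then show "is_lub M c ((\<lambda>_. c) ` X)" using assms(2) by (simp add: least_def Upper_def)
qed (rule assms(2))

lemma scott_continuous_id: "scott_continuous L L (\<lambda>x. x)"
  by (rule scott_continuousI) simp_all

text \<open>The form in which continuity bounds a value at a supremum: it suffices to test the
  members of the directed set.\<close>

lemma scott_continuous_le:
  assumes "scott_continuous L M f" "directed L X" "is_lub L u X" "v \<in> carrier M"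
    and "\<And>x. x \<in> X \<Longrightarrow> f x \<sqsubseteq>\<^bsub>M\<^esub> v"
  shows "f u \<sqsubseteq>\<^bsub>M\<^esub> v"
proof (rule is_lubD(3)[OF scott_continuous_lub[OF assms(1-3)] _ assms(4)])
  show "f ` X \<subseteq> carrier M"
    using directed_subset[OF assms(2)] scott_continuous_car[OF assms(1)] by blast
qed (use assms(5) in auto)

text \<open>Separate continuity gives joint continuity: by directedness, pairs of members of
  \<open>X\<close> are dominated by diagonal pairs, and the two suprema can then be taken one after
  the other. This serves the application case of the interpretation.\<close>

lemma scott_continuous_binop:
  assumes "partial_order L" "partial_order M" "partial_order N" "partial_order K"
    and h1: "\<And>b. b \<in> carrier N \<Longrightarrow> scott_continuous M K (\<lambda>a. h a b)"
    and h2: "\<And>a. a \<in> carrier M \<Longrightarrow> scott_continuous N K (h a)"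
    and f: "scott_continuous L M f" and g: "scott_continuous L N g"
  shows "scott_continuous L K (\<lambda>x. h (f x) (g x))"
proof (rule scott_continuousI)
  interpret L: partial_order L by fact
  interpret K: partial_order K by fact
  have hc: "h a b \<in> carrier K" if "a \<in> carrier M" "b \<in> carrier N" for a b
    using scott_continuous_car[OF h2[OF that(1)] that(2)] .
  note fc = scott_continuous_car[OF f] and gc = scott_continuous_car[OF g]
  show "h (f x) (g x) \<in> carrier K" if "x \<in> carrier L" for x
    using hc fc gc that by blast
  fix X u assume X: "directed L X" "is_lub L u X" "u \<in> carrier L"
  note Xs = directed_subset[OF X(1)]
  have mono: "h (f x) (g y) \<sqsubseteq>\<^bsub>K\<^esub> h (f x') (g y')"
    if c: "x \<in> carrier L" "y \<in> carrier L" "x' \<in> carrier L" "y' \<in> carrier L"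
      and le: "x \<sqsubseteq>\<^bsub>L\<^esub> x'" "y \<sqsubseteq>\<^bsub>L\<^esub> y'" for x y x' y'
  proof (rule K.le_trans)
    show "h (f x) (g y) \<sqsubseteq>\<^bsub>K\<^esub> h (f x') (g y)"
      by (rule scott_continuous_mono[OF assms(2) h1])
        (intro fc gc c scott_continuous_mono[OF assms(1) f] le)+
    show "h (f x') (g y) \<sqsubseteq>\<^bsub>K\<^esub> h (f x') (g y')"
      by (rule scott_continuous_mono[OF assms(3) h2])
        (intro fc gc c scott_continuous_mono[OF assms(1) g] le)+
  qed (intro hc fc gc c)+
  show "is_lub K (h (f u) (g u)) ((\<lambda>x. h (f x) (g x)) ` X)"
  proof (rule is_lubI)
    show "h (f u) (g u) \<in> carrier K" using hc fc gc X(3) by blast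
    fix a assume "a \<in> (\<lambda>x. h (f x) (g x)) ` X"
    then obtain x where x: "x \<in> X" "a = h (f x) (g x)" by blast
    show "a \<sqsubseteq>\<^bsub>K\<^esub> h (f u) (g u)"
      unfolding x(2) using x(1) Xs X(3) is_lubD(2)[OF X(2) Xs] by (intro mono) auto
  next
    fix v assume v: "v \<in> carrier K"
      "\<And>a. a \<in> (\<lambda>x. h (f x) (g x)) ` X \<Longrightarrow> a \<in> carrier K \<Longrightarrow> a \<sqsubseteq>\<^bsub>K\<^esub> v"
    \<comment> \<open>A common upper bound \<open>z\<close> of \<open>x\<close> and \<open>y\<close>
      in \<open>X\<close> leads back to the diagonal, which \<open>v\<close> bounds by
      assumption.\<close>
    have xy: "h (f x) (g y) \<sqsubseteq>\<^bsub>K\<^esub> v" if that': "x \<in> X" "y \<in> X" for x y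
    proof -
      obtain z where z: "z \<in> X" "x \<sqsubseteq>\<^bsub>L\<^esub> z" "y \<sqsubseteq>\<^bsub>L\<^esub> z"
        using X(1) that' unfolding directed_def by blast
      have c: "x \<in> carrier L" "y \<in> carrier L" "z \<in> carrier L" using that' z(1) Xs by auto
      have "h (f z) (g z) \<sqsubseteq>\<^bsub>K\<^esub> v" by (rule v(2)[OF image_eqI[OF refl z(1)] hc[OF fc gc]]) (rule c(3))+
      with mono[OF c(1,2,3,3) z(2,3)] show ?thesis
        by (rule K.le_trans) (intro hc fc gc c v(1))+
    qed
    \<comment> \<open>The second argument passes to the supremum first, with the first one
      fixed.\<close>
    have xu: "h (f x) (g u) \<sqsubseteq>\<^bsub>K\<^esub> v" if x: "x \<in> X" for x
    proof -
      have "f x \<in> carrier M" using x Xs fc by blast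
      from scott_continuous_comp[OF assms(1) g h2[OF this]] X(1,2) v(1) xy[OF x]
      show ?thesis by (rule scott_continuous_le)
    qed
    from scott_continuous_comp[OF assms(1) f h1[OF gc[OF X(3)]]] X(1,2) v(1) xu
    show "h (f u) (g u) \<sqsubseteq>\<^bsub>K\<^esub> v" by (rule scott_continuous_le)
  qed
qed

text \<open>Suprema commute: an upper bound of the \<open>g x\<close> bounds every
  \<open>f i x\<close>, hence every \<open>f i u\<close> by continuity, hence \<open>g u\<close>.
  Application is a supremum of approximations and inherits continuity from them this way.\<close>

lemma scott_continuous_Sup:
  assumes "partial_order L" "partial_order M"
    and f: "\<And>i. i \<in> I \<Longrightarrow> scott_continuous L M (f i)"
    and g: "\<And>x. x \<in> carrier L \<Longrightarrow> is_lub M (g x) ((\<lambda>i. f i x) ` I)"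
  shows "scott_continuous L M g"
proof -
  interpret M: partial_order M by fact
  have fc: "f i x \<in> carrier M" if "i \<in> I" "x \<in> carrier L" for i x
    using scott_continuous_car[OF f[OF that(1)] that(2)] .
  have sub: "(\<lambda>i. f i x) ` I \<subseteq> carrier M" if "x \<in> carrier L" for x
    using fc that by blast
  have gc: "g x \<in> carrier M" if "x \<in> carrier L" for x
    using is_lubD(1)[OF g[OF that] sub[OF that]] .
  have fg: "f i x \<sqsubseteq>\<^bsub>M\<^esub> g x" if "i \<in> I" "x \<in> carrier L" for i x
    using is_lubD(2)[OF g[OF that(2)] sub[OF that(2)]] that(1) by blast
  have gl: "g x \<sqsubseteq>\<^bsub>M\<^esub> v" if "x \<in> carrier L" "v \<in> carrier M" "\<And>i. i \<in> I \<Longrightarrow> f i x \<sqsubseteq>\<^bsub>M\<^esub> v" for x v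
    using is_lubD(3)[OF g[OF that(1)] sub[OF that(1)] that(2)] that(3) by blast
  show ?thesis
  proof (rule scott_continuousI)
    fix X u assume X: "directed L X" "is_lub L u X" "u \<in> carrier L"
    note Xs = directed_subset[OF X(1)]
    show "is_lub M (g u) (g ` X)"
    proof (rule is_lubI)
      fix a assume "a \<in> g ` X"
      then obtain x where x: "x \<in> X" "a = g x" by blast
      then have xc: "x \<in> carrier L" using Xs by blast
      show "a \<sqsubseteq>\<^bsub>M\<^esub> g u"
        unfolding x(2)
      proof (rule gl[OF xc gc[OF X(3)]])
        fix i assume i: "i \<in> I"
        have "f i x \<sqsubseteq>\<^bsub>M\<^esub> f i u"
          by (rule scott_continuous_mono[OF assms(1) f[OF i] xc X(3) is_lubD(2)[OF X(2) Xs x(1)]])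
        then show "f i x \<sqsubseteq>\<^bsub>M\<^esub> g u"
          by (rule M.le_trans) (intro fg fc gc i xc X(3))+
      qed
    next
      fix v assume v: "v \<in> carrier M" "\<And>a. a \<in> g ` X \<Longrightarrow> a \<in> carrier M \<Longrightarrow> a \<sqsubseteq>\<^bsub>M\<^esub> v"
      show "g u \<sqsubseteq>\<^bsub>M\<^esub> v"
      proof (rule gl[OF X(3) v(1)])
        fix i assume i: "i \<in> I"
        from f[OF i] X(1,2) v(1) show "f i u \<sqsubseteq>\<^bsub>M\<^esub> v"
        proof (rule scott_continuous_le)
          fix x assume x: "x \<in> X"
          then have xc: "x \<in> carrier L" using Xs by blast
          show "f i x \<sqsubseteq>\<^bsub>M\<^esub> v"
            by (rule M.le_trans[OF fg[OF i xc] v(2)]) (intro imageI fc gc i xc v(1) x)+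
        qed
      qed
    qed (rule gc[OF X(3)])
  qed (rule gc)
qed

text \<open>The order of \<open>fun_space M\<close> is pointwise, so a least upper bound may be
  checked at each argument \<open>d\<close> separately.\<close>

lemma scott_continuous_into_fun_space:
  assumes "small (carrier M)"
    and "\<And>x. x \<in> carrier L \<Longrightarrow> f x \<in> carrier (fun_space M)"
    and "\<And>d. d \<in> carrier M \<Longrightarrow> scott_continuous L M (\<lambda>x. ap (f x) d)"
  shows "scott_continuous L (fun_space M) f"
proof (rule scott_continuousI)
  fix X u assume X: "directed L X" "is_lub L u X" "u \<in> carrier L"
  note Xs = directed_subset[OF X(1)]
  have lub: "is_lub M (ap (f u) d) ((\<lambda>x. ap (f x) d) ` X)" if "d \<in> carrier M" for d
    using scott_continuous_lub[OF assms(3)[OF that] X(1,2)] .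
  have sub: "(\<lambda>x. ap (f x) d) ` X \<subseteq> carrier M" if "d \<in> carrier M" for d
    using scott_continuous_car[OF assms(3)[OF that]] Xs by blast
  show "is_lub (fun_space M) (f u) (f ` X)"
  proof (rule is_lubI)
    show "f u \<in> carrier (fun_space M)" using assms(2) X(3) .
    show "a \<sqsubseteq>\<^bsub>fun_space M\<^esub> f u" if "a \<in> f ` X" for a
      using that is_lubD(2)[OF lub sub] by (auto simp: fun_space_le)
    fix v assume v: "v \<in> carrier (fun_space M)"
      "\<And>a. a \<in> f ` X \<Longrightarrow> a \<in> carrier (fun_space M) \<Longrightarrow> a \<sqsubseteq>\<^bsub>fun_space M\<^esub> v"
    show "f u \<sqsubseteq>\<^bsub>fun_space M\<^esub> v"
      unfolding fun_space_le
    proof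
      fix d assume d: "d \<in> carrier M"
      have le: "ap (f x) d \<sqsubseteq>\<^bsub>M\<^esub> ap v d" if x: "x \<in> X" for x
        using v(2)[OF imageI[OF x] assms(2)[OF subsetD[OF Xs x]]] d by (simp add: fun_space_le)
      show "ap (f u) d \<sqsubseteq>\<^bsub>M\<^esub> ap v d"
        by (rule scott_continuous_le[OF assms(3)[OF d] X(1,2)])
          (use scott_continuous_car[OF fun_space_memD(1)[OF assms(1) v(1)] d] le in auto)
    qed
  qed
qed (rule assms(2))

text \<open>\<open>fun_space_lub\<close> yields some least upper bound that is computed pointwise;
  uniqueness identifies it with the given \<open>u\<close>.\<close>

lemma scott_continuous_eval:
  assumes "cpo L" "small (carrier L)" "d \<in> carrier L"
  shows "scott_continuous (fun_space L) L (\<lambda>x. ap x d)"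
proof (rule scott_continuousI)
  show "ap x d \<in> carrier L" if "x \<in> carrier (fun_space L)" for x
    using scott_continuous_car[OF fun_space_memD(1)[OF assms(2) that] assms(3)] .
  fix X u assume X: "directed (fun_space L) X" "is_lub (fun_space L) u X"
  obtain w where w: "is_lub (fun_space L) w X" "is_lub L (ap w d) ((\<lambda>x. ap x d) ` X)"
    using fun_space_lub[OF assms(1,2) X(1)] assms(3) by blast
  have "partial_order (fun_space L)" using fun_space_cpo[OF assms(1,2)] by (simp add: cpo_def)
  from is_lub_unique[OF this w(1) X(2)] w(2)
  show "is_lub L (ap u d) ((\<lambda>x. ap x d) ` X)" by simp
qed

text \<open>An element is the canonical code of its own function, so its values on the carrier
  determine it.\<close>

lemma fun_space_eqI:
  assumes "small (carrier L)" "x \<in> carrier (fun_space L)" "y \<in> carrier (fun_space L)"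
    and "\<And>d. d \<in> carrier L \<Longrightarrow> ap x d = ap y d"
  shows "x = y"
  using fun_space_memD(2)[OF assms(1,2)] fun_space_memD(2)[OF assms(1,3)] assms(4)
  by (metis fn_cong)

text \<open>At \<open>d\<close> the image of \<open>x\<close> is \<open>p\<close> of the value of
  \<open>x\<close> at \<open>q d\<close>, hence continuous in \<open>x\<close>. Both
  \<open>phi (Suc n)\<close> and \<open>psi (Suc n)\<close> have this shape, with the roles of
  \<open>phi n\<close> and \<open>psi n\<close> exchanged.\<close>

lemma scott_continuous_conjugate:
  assumes "cpo L" "cpo M" "small (carrier L)" "small (carrier M)"
    and p: "scott_continuous L M p" and q: "scott_continuous M L q"
  shows "scott_continuous (fun_space L) (fun_space M) (\<lambda>x. fn (carrier M) (p \<circ> ap x \<circ> q))"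
proof (rule scott_continuous_into_fun_space[OF assms(4)])
  have po: "partial_order L" "partial_order M" using assms(1,2) by (simp_all add: cpo_def)
  have poF: "partial_order (fun_space L)" by (rule fun_space_partial_order[OF po(1) assms(3)])
  show "fn (carrier M) (p \<circ> ap x \<circ> q) \<in> carrier (fun_space M)" if "x \<in> carrier (fun_space L)" for x
    using scott_continuous_comp[OF po(2) scott_continuous_comp[OF po(2) q fun_space_memD(1)[OF assms(3) that]] p]
    by (intro fun_space_memI) (simp add: comp_def)
  fix d assume d: "d \<in> carrier M"
  show "scott_continuous (fun_space L) M (\<lambda>x. ap (fn (carrier M) (p \<circ> ap x \<circ> q)) d)"
    using scott_continuous_comp[OF poF scott_continuous_eval[OF assms(1,3) scott_continuous_car[OF q d]] p]
    by (simp add: ap_fn[OF assms(4) d])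
qed

section \<open>The projective limit\<close>

lemma D_partial_order: "partial_order (D n)"
  using D_cpo[of n] by (simp add: cpo_def)

lemma scott_continuous_ap:
  "x \<in> carrier (D (Suc n)) \<Longrightarrow> scott_continuous (D n) (D n) (ap x)"
  using fun_space_memD(1)[OF D_small] by simp

lemma D_bottom:
  shows "\<bottom>\<^bsub>D n\<^esub> \<in> carrier (D n)" "d \<in> carrier (D n) \<Longrightarrow> \<bottom>\<^bsub>D n\<^esub> \<sqsubseteq>\<^bsub>D n\<^esub> d"
proof -
  have "least (D n) \<bottom>\<^bsub>D n\<^esub> (carrier (D n))"
    unfolding bottom_def using cpo.bottom_exists[OF D_cpo] by (rule someI_ex)
  then show "\<bottom>\<^bsub>D n\<^esub> \<in> carrier (D n)" "d \<in> carrier (D n) \<Longrightarrow> \<bottom>\<^bsub>D n\<^esub> \<sqsubseteq>\<^bsub>D n\<^esub> d"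
    by (auto simp: least_def)
qed

text \<open>The claims go through the induction together: the conjugations at \<open>Suc n\<close>
  need both maps at \<open>n\<close> to be continuous, and the two laws at \<open>Suc n\<close> come
  from those at \<open>n\<close>, applied to arguments and to values.\<close>

lemma phi_psi_embedding_projection:
  "scott_continuous (D n) (D (Suc n)) (phi n) \<and> scott_continuous (D (Suc n)) (D n) (psi n) \<and>
    (\<forall>x\<in>carrier (D n). psi n (phi n x) = x) \<and>
    (\<forall>y\<in>carrier (D (Suc n)). phi n (psi n y) \<sqsubseteq>\<^bsub>D (Suc n)\<^esub> y)"
proof (induction n)
  case 0
  let ?L = "D 0"
  have ap: "ap (phi 0 x) d = x" if "d \<in> carrier ?L" for x d
    using ap_fn[OF D_small that, of "\<lambda>_. x"] by simp
  have "scott_continuous ?L (fun_space ?L) (phi 0)"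
  proof (rule scott_continuous_into_fun_space[OF D_small])
    show "phi 0 x \<in> carrier (fun_space ?L)" if "x \<in> carrier ?L" for x
      using fun_space_memI[OF scott_continuous_const[OF D_partial_order that]] by simp
    show "scott_continuous ?L ?L (\<lambda>x. ap (phi 0 x) d)" if "d \<in> carrier ?L" for d
      unfolding ap[OF that] by (rule scott_continuous_id)
  qed
  moreover have "scott_continuous (fun_space ?L) ?L (psi 0)"
    using scott_continuous_eval[OF D_cpo D_small D_bottom(1), of 0] by simp
  moreover have "psi 0 (phi 0 x) = x" for x
    using ap[OF D_bottom(1)] by simp
  moreover have "phi 0 (psi 0 y) \<sqsubseteq>\<^bsub>fun_space ?L\<^esub> y" if y: "y \<in> carrier (fun_space ?L)" for y
    unfolding fun_space_le
  proof
    fix d assume d: "d \<in> carrier ?L"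
    \<comment> \<open>\<open>phi 0 (psi 0 y)\<close> is constantly the value of \<open>y\<close> at
      bottom, which lies below every value of \<open>y\<close> by monotonicity.\<close>
    have "scott_continuous ?L ?L (ap y)" using y by (intro scott_continuous_ap) simp
    from scott_continuous_mono[OF D_partial_order this D_bottom(1) d D_bottom(2)[OF d]]
    show "ap (phi 0 (psi 0 y)) d \<sqsubseteq>\<^bsub>?L\<^esub> ap y d" unfolding ap[OF d] by simp
  qed
  ultimately show ?case by simp
next
  case (Suc n)
  let ?L = "D n" and ?M = "D (Suc n)"
  have phi: "scott_continuous ?L ?M (phi n)" and psi: "scott_continuous ?M ?L (psi n)"
    and id: "\<And>x. x \<in> carrier ?L \<Longrightarrow> psi n (phi n x) = x"
    and le: "\<And>y. y \<in> carrier ?M \<Longrightarrow> phi n (psi n y) \<sqsubseteq>\<^bsub>?M\<^esub> y"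
    using Suc.IH by blast+
  note phic = scott_continuous_car[OF phi] and psic = scott_continuous_car[OF psi]
  have M: "?M = fun_space ?L" and N: "D (Suc (Suc n)) = fun_space ?M" by simp_all
  have phiS: "phi (Suc n) = (\<lambda>x. fn (carrier ?M) (phi n \<circ> ap x \<circ> psi n))"
    and psiS: "psi (Suc n) = (\<lambda>x. fn (carrier ?L) (psi n \<circ> ap x \<circ> phi n))"
    by (simp_all add: fun_eq_iff)
  have ap_phi: "ap (phi (Suc n) x) d = phi n (ap x (psi n d))" if "d \<in> carrier ?M" for x d
    unfolding phiS using ap_fn[OF D_small that] by (simp only: comp_apply)
  have ap_psi: "ap (psi (Suc n) x) d = psi n (ap x (phi n d))" if "d \<in> carrier ?L" for x d
    unfolding psiS using ap_fn[OF D_small that] by (simp only: comp_apply)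
  have phi': "scott_continuous ?M (D (Suc (Suc n))) (phi (Suc n))"
    unfolding phiS N
    using scott_continuous_conjugate[OF D_cpo D_cpo D_small D_small phi psi] unfolding M[symmetric] .
  have psi': "scott_continuous (D (Suc (Suc n))) ?M (psi (Suc n))"
    unfolding psiS N
    using scott_continuous_conjugate[OF D_cpo D_cpo D_small D_small psi phi] unfolding M[symmetric] .
  have "psi (Suc n) (phi (Suc n) x) = x" if x: "x \<in> carrier ?M" for x
  proof (rule fun_space_eqI[OF D_small])
    show "psi (Suc n) (phi (Suc n) x) \<in> carrier (fun_space ?L)"
      using scott_continuous_car[OF psi' scott_continuous_car[OF phi' x]] unfolding M .
    show "x \<in> carrier (fun_space ?L)" using x unfolding M .
    fix d assume d: "d \<in> carrier ?L"
    note c = scott_continuous_car[OF scott_continuous_ap[OF x] d]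
    show "ap (psi (Suc n) (phi (Suc n) x)) d = ap x d"
      \<comment> \<open>The projection cancels the embedding twice, around the argument
        \<open>d\<close> and around the value \<open>ap x d\<close>.\<close>
      by (simp only: ap_psi[OF d] ap_phi[OF phic[OF d]] id[OF d] id[OF c])
  qed
  moreover have "phi (Suc n) (psi (Suc n) y) \<sqsubseteq>\<^bsub>D (Suc (Suc n))\<^esub> y"
    if y: "y \<in> carrier (D (Suc (Suc n)))" for y
    unfolding N fun_space_le
  proof
    interpret partial_order ?M by (rule D_partial_order)
    fix d assume d: "d \<in> carrier ?M"
    let ?d = "phi n (psi n d)"
    have d': "?d \<in> carrier ?M" using phic[OF psic[OF d]] .
    note apc = scott_continuous_car[OF scott_continuous_ap[OF y]]
    \<comment> \<open>The law \<open>le\<close> acts on the value here and on the argument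
      \<open>d\<close> in the next comparison, where \<open>ap y\<close> is monotone.\<close>
    have "phi n (psi n (ap y ?d)) \<sqsubseteq>\<^bsub>?M\<^esub> ap y ?d" using le[OF apc[OF d']] .
    moreover have "ap y ?d \<sqsubseteq>\<^bsub>?M\<^esub> ap y d"
      by (rule scott_continuous_mono[OF D_partial_order scott_continuous_ap[OF y] d' d le[OF d]])
    ultimately have "phi n (psi n (ap y ?d)) \<sqsubseteq>\<^bsub>?M\<^esub> ap y d"
      by (rule le_trans) (intro phic psic apc d)+
    then show "ap (phi (Suc n) (psi (Suc n) y)) d \<sqsubseteq>\<^bsub>?M\<^esub> ap y d"
      unfolding ap_phi[OF d] ap_psi[OF psic[OF d]] .
  qed
  ultimately show ?case using phi' psi' by blast
qed

lemma scott_continuous_phi: "scott_continuous (D n) (D (Suc n)) (phi n)"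
  and scott_continuous_psi: "scott_continuous (D (Suc n)) (D n) (psi n)"
  and psi_phi: "x \<in> carrier (D n) \<Longrightarrow> psi n (phi n x) = x"
  and phi_psi_le: "y \<in> carrier (D (Suc n)) \<Longrightarrow> phi n (psi n y) \<sqsubseteq>\<^bsub>D (Suc n)\<^esub> y"
  using phi_psi_embedding_projection[of n] by blast+

lemmas phi_closed = scott_continuous_car[OF scott_continuous_phi]
  and psi_closed = scott_continuous_car[OF scott_continuous_psi]
  and ap_closed = scott_continuous_car[OF scott_continuous_ap]
  and phi_mono = scott_continuous_mono[OF D_partial_order scott_continuous_phi]
  and psi_mono = scott_continuous_mono[OF D_partial_order scott_continuous_psi]
  and ap_mono = scott_continuous_mono[OF D_partial_order scott_continuous_ap]

lemma ap_psi_Suc: "d \<in> carrier (D n) \<Longrightarrow> ap (psi (Suc n) x) d = psi n (ap x (phi n d))"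
  using ap_fn[OF D_small, of d n "psi n \<circ> ap x \<circ> phi n"] by simp

section \<open>Order and directed suprema of the limit\<close>

lemma D_inf_mem_iff:
  "d \<in> carrier D_inf \<longleftrightarrow> (\<forall>n. d n \<in> carrier (D n) \<and> psi n (d (Suc n)) = d n)"
  by (simp add: D_inf_def)

lemma D_inf_closed: "d \<in> carrier D_inf \<Longrightarrow> d n \<in> carrier (D n)"
  and D_inf_psi: "d \<in> carrier D_inf \<Longrightarrow> psi n (d (Suc n)) = d n"
  by (simp_all add: D_inf_mem_iff)

lemma D_inf_le_iff: "d \<sqsubseteq>\<^bsub>D_inf\<^esub> e \<longleftrightarrow> (\<forall>n. d n \<sqsubseteq>\<^bsub>D n\<^esub> e n)"
  by (simp add: D_inf_def)

lemma D_inf_leD: "d \<sqsubseteq>\<^bsub>D_inf\<^esub> e \<Longrightarrow> d n \<sqsubseteq>\<^bsub>D n\<^esub> e n"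
  by (simp add: D_inf_le_iff)

lemma D_inf_partial_order: "partial_order D_inf"
proof (rule partial_orderI_eq)
  show "eq D_inf = (=)" by (simp add: D_inf_def)
  note refl = partial_order.axioms(1)[OF D_partial_order, THEN weak_partial_order.le_refl]
  note trans = partial_order.axioms(1)[OF D_partial_order, THEN weak_partial_order.le_trans]
  note antisym = partial_order.le_antisym[OF D_partial_order]
  show "x \<sqsubseteq>\<^bsub>D_inf\<^esub> x" if "x \<in> carrier D_inf" for x
    unfolding D_inf_le_iff using refl D_inf_closed[OF that] by blast
  show "x = y"
    if "x \<sqsubseteq>\<^bsub>D_inf\<^esub> y" "y \<sqsubseteq>\<^bsub>D_inf\<^esub> x" "x \<in> carrier D_inf" "y \<in> carrier D_inf" for x y
    by (rule ext, rule antisym[OF D_inf_leD[OF that(1)] D_inf_leD[OF that(2)]])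
      (intro D_inf_closed that)+
  show "x \<sqsubseteq>\<^bsub>D_inf\<^esub> z"
    if "x \<sqsubseteq>\<^bsub>D_inf\<^esub> y" "y \<sqsubseteq>\<^bsub>D_inf\<^esub> z" "x \<in> carrier D_inf" "y \<in> carrier D_inf" "z \<in> carrier D_inf"
    for x y z
    unfolding D_inf_le_iff
    using trans[OF D_inf_leD[OF that(1)] D_inf_leD[OF that(2)]] D_inf_closed that(3-5) by blast
qed

lemma D_inf_is_lubI:
  assumes "X \<subseteq> carrier D_inf" "u \<in> carrier D_inf" "\<And>n. is_lub (D n) (u n) ((\<lambda>x. x n) ` X)"
  shows "is_lub D_inf u X"
proof (rule is_lubI[OF assms(2)])
  have sub: "(\<lambda>x. x n) ` X \<subseteq> carrier (D n)" for n using assms(1) D_inf_closed by blast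
  show "x \<sqsubseteq>\<^bsub>D_inf\<^esub> u" if "x \<in> X" for x
    unfolding D_inf_le_iff using is_lubD(2)[OF assms(3) sub] that by blast
  fix v assume v: "v \<in> carrier D_inf" "\<And>x. x \<in> X \<Longrightarrow> x \<in> carrier D_inf \<Longrightarrow> x \<sqsubseteq>\<^bsub>D_inf\<^esub> v"
  have "x n \<sqsubseteq>\<^bsub>D n\<^esub> v n" if "x \<in> X" for x n
    using D_inf_leD[OF v(2)[OF that subsetD[OF assms(1) that]]] .
  then show "u \<sqsubseteq>\<^bsub>D_inf\<^esub> v"
    unfolding D_inf_le_iff using is_lubD(3)[OF assms(3) sub D_inf_closed[OF v(1)]] by blast
qed

lemma D_inf_directed_proj:
  assumes "directed D_inf X" shows "directed (D n) ((\<lambda>x. x n) ` X)"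
  unfolding directed_def
proof (intro conjI ballI)
  show "(\<lambda>x. x n) ` X \<subseteq> carrier (D n)" using directed_subset[OF assms] D_inf_closed by blast
  show "(\<lambda>x. x n) ` X \<noteq> {}" using assms by (auto simp: directed_def)
  fix a b assume "a \<in> (\<lambda>x. x n) ` X" "b \<in> (\<lambda>x. x n) ` X"
  then obtain x y where xy: "x \<in> X" "y \<in> X" "a = x n" "b = y n" by blast
  then obtain z where "z \<in> X" "x \<sqsubseteq>\<^bsub>D_inf\<^esub> z" "y \<sqsubseteq>\<^bsub>D_inf\<^esub> z"
    using assms unfolding directed_def by blast
  then show "\<exists>z\<in>(\<lambda>x. x n) ` X. a \<sqsubseteq>\<^bsub>D n\<^esub> z \<and> b \<sqsubseteq>\<^bsub>D n\<^esub> z"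
    using xy(3,4) D_inf_leD by blast
qed

text \<open>The componentwise suprema form a compatible sequence, since \<open>psi n\<close> is
  continuous and carries the components \<open>Suc n\<close> of the members to their components
  \<open>n\<close>.\<close>

lemma D_inf_directed_lub:
  assumes X: "directed D_inf X"
  shows "\<exists>u. is_lub D_inf u X \<and> (\<forall>n. is_lub (D n) (u n) ((\<lambda>x. x n) ` X))"
proof -
  note Xs = directed_subset[OF X]
  have "\<forall>n. \<exists>v. is_lub (D n) v ((\<lambda>x. x n) ` X)"
    using cpo.directed_lub_exists[OF D_cpo D_inf_directed_proj[OF X]] by blast
  then obtain u where u: "\<And>n. is_lub (D n) (u n) ((\<lambda>x. x n) ` X)" by metis
  have "u \<in> carrier D_inf"
    unfolding D_inf_mem_iff
  proof (intro allI conjI)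
    fix n
    show "u n \<in> carrier (D n)"
      using is_lubD(1)[OF u directed_subset[OF D_inf_directed_proj[OF X]]] .
    have "is_lub (D n) (psi n (u (Suc n))) (psi n ` (\<lambda>x. x (Suc n)) ` X)"
      by (rule scott_continuous_lub[OF scott_continuous_psi D_inf_directed_proj[OF X] u])
    moreover have "psi n ` (\<lambda>x. x (Suc n)) ` X = (\<lambda>x. x n) ` X"
      unfolding image_image using Xs D_inf_psi by (intro image_cong) auto
    ultimately show "psi n (u (Suc n)) = u n"
      using is_lub_unique[OF D_partial_order _ u] by metis
  qed
  with D_inf_is_lubI[OF Xs] u show ?thesis by blast
qed

lemma scott_continuous_proj: "scott_continuous D_inf (D n) (\<lambda>x. x n)"
proof (rule scott_continuousI)
  fix X u assume X: "directed D_inf X" "is_lub D_inf u X"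
  obtain w where w: "is_lub D_inf w X" "is_lub (D n) (w n) ((\<lambda>x. x n) ` X)"
    using D_inf_directed_lub[OF X(1)] by blast
  with is_lub_unique[OF D_inf_partial_order X(2) w(1)]
  show "is_lub (D n) (u n) ((\<lambda>x. x n) ` X)" by simp
qed (rule D_inf_closed)

lemma scott_continuous_into_D_inf:
  assumes "\<And>x. x \<in> carrier L \<Longrightarrow> f x \<in> carrier D_inf"
    and "\<And>n. scott_continuous L (D n) (\<lambda>x. f x n)"
  shows "scott_continuous L D_inf f"
proof (rule scott_continuousI)
  fix X u assume X: "directed L X" "is_lub L u X" "u \<in> carrier L"
  have "f ` X \<subseteq> carrier D_inf" using directed_subset[OF X(1)] assms(1) by blast
  then show "is_lub D_inf (f u) (f ` X)"
  proof (rule D_inf_is_lubI[OF _ assms(1)[OF X(3)]])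
    show "is_lub (D n) (f u n) ((\<lambda>x. x n) ` f ` X)" for n
      unfolding image_image using scott_continuous_lub[OF assms(2) X(1,2)] .
  qed
qed (rule assms(1))

section \<open>Embeddings of the stages into the limit\<close>

lemma phi_inf_self: "phi_inf n x n = x"
  by (simp add: phi_inf_def)

text \<open>For \<open>Suc m = n\<close> the right side falls under the \<open>fold\<close> branch,
  which is the identity there.\<close>

lemma phi_inf_less: "m < n \<Longrightarrow> phi_inf n x m = psi m (phi_inf n x (Suc m))"
  by (auto simp: phi_inf_def upt_conv_Cons not_less dest: le_antisym)

lemma phi_inf_ge: "n \<le> m \<Longrightarrow> phi_inf n x (Suc m) = phi m (phi_inf n x m)"
  by (simp add: phi_inf_def)

text \<open>Induction starts at component \<open>n\<close> and runs down along \<open>psi\<close>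
  and up along \<open>phi\<close>.\<close>

lemma scott_continuous_phi_inf_nth: "scott_continuous (D n) (D m) (\<lambda>x. phi_inf n x m)"
proof (cases "m \<le> n")
  case True
  then show ?thesis
  proof (induction m rule: inc_induct)
    case base
    show ?case unfolding phi_inf_self by (rule scott_continuous_id)
  next
    case (step m)
    show ?case unfolding phi_inf_less[OF step.hyps(2)]
      by (rule scott_continuous_comp[OF D_partial_order step.IH scott_continuous_psi])
  qed
next
  case False
  then have "n \<le> m" by simp
  then show ?thesis
  proof (induction m rule: dec_induct)
    case base
    show ?case unfolding phi_inf_self by (rule scott_continuous_id)
  next
    case (step m)
    show ?case unfolding phi_inf_ge[OF step.hyps(1)]
      by (rule scott_continuous_comp[OF D_partial_order step.IH scott_continuous_phi])
  qed
qed

text \<open>Compatibility is built in below \<open>n\<close>; from \<open>n\<close> on it is the law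
  \<open>psi_phi\<close>.\<close>

lemma phi_inf_closed: "x \<in> carrier (D n) \<Longrightarrow> phi_inf n x \<in> carrier D_inf"
  unfolding D_inf_mem_iff
proof (intro allI conjI)
  fix m assume x: "x \<in> carrier (D n)"
  show c: "phi_inf n x m \<in> carrier (D m)"
    by (rule scott_continuous_car[OF scott_continuous_phi_inf_nth x])
  show "psi m (phi_inf n x (Suc m)) = phi_inf n x m"
  proof (cases "m < n")
    case False
    then show ?thesis using psi_phi[OF c] by (simp add: phi_inf_ge)
  qed (simp add: phi_inf_less)
qed

lemma scott_continuous_phi_inf: "scott_continuous (D n) D_inf (phi_inf n)"
  by (rule scott_continuous_into_D_inf[OF phi_inf_closed scott_continuous_phi_inf_nth])

lemmas phi_inf_mono = scott_continuous_mono[OF D_partial_order scott_continuous_phi_inf]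

text \<open>At component \<open>n\<close> the projection cancels \<open>phi n\<close>, and on either
  side both sequences continue by the same maps. Passing through the next stage thus does not change
  the embedded element.\<close>

lemma phi_inf_phi:
  assumes "x \<in> carrier (D n)" shows "phi_inf (Suc n) (phi n x) = phi_inf n x"
proof
  fix m
  show "phi_inf (Suc n) (phi n x) m = phi_inf n x m"
  proof (cases "m \<le> n")
    case True
    then show ?thesis
    proof (induction m rule: inc_induct)
      case base
      show ?case using assms by (simp add: phi_inf_less phi_inf_self psi_phi)
    next
      case (step m)
      then show ?case by (simp add: phi_inf_less)
    qed
  next
    case False
    then have "Suc n \<le> m" by simp
    then show ?thesis
    proof (induction m rule: dec_induct)
      case base
      show ?case by (simp add: phi_inf_self phi_inf_ge)
    next
      case (step m)
      then show ?case by (simp add: phi_inf_ge)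
    qed
  qed
qed

lemma phi_inf_proj_nth:
  assumes "a \<in> carrier D_inf" "m \<le> n" shows "phi_inf n (a n) m = a m"
  using assms(2)
proof (induction m rule: inc_induct)
  case (step m)
  then show ?case using D_inf_psi[OF assms(1)] by (simp add: phi_inf_less)
qed (simp add: phi_inf_self)

text \<open>Up to component \<open>n\<close> there is equality; above it each step adds one use of
  \<open>phi_psi_le\<close>.\<close>

lemma phi_inf_proj_le:
  assumes a: "a \<in> carrier D_inf" shows "phi_inf n (a n) \<sqsubseteq>\<^bsub>D_inf\<^esub> a"
  unfolding D_inf_le_iff
proof
  fix m
  have refl: "d \<sqsubseteq>\<^bsub>D m\<^esub> d" if "d \<in> carrier (D m)" for d m
  proof -
    interpret partial_order "D m" by (rule D_partial_order)
    show ?thesis using that by simp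
  qed
  show "phi_inf n (a n) m \<sqsubseteq>\<^bsub>D m\<^esub> a m"
  proof (cases "m \<le> n")
    case True
    then show ?thesis using refl D_inf_closed[OF a] phi_inf_proj_nth[OF a] by simp
  next
    case False
    then have "n \<le> m" by simp
    then show ?thesis
    proof (induction m rule: dec_induct)
      case base
      show ?case using refl D_inf_closed[OF a] by (simp add: phi_inf_self)
    next
      case (step m)
      interpret partial_order "D (Suc m)" by (rule D_partial_order)
      have c: "phi_inf n (a n) m \<in> carrier (D m)"
        by (intro D_inf_closed phi_inf_closed a)
      have "phi m (phi_inf n (a n) m) \<sqsubseteq>\<^bsub>D (Suc m)\<^esub> phi m (a m)"
        by (intro phi_mono c D_inf_closed a step.IH)
      moreover have "phi m (a m) \<sqsubseteq>\<^bsub>D (Suc m)\<^esub> a (Suc m)"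
        using phi_psi_le[OF D_inf_closed[OF a, of "Suc m"]] unfolding D_inf_psi[OF a] .
      ultimately show ?case
        unfolding phi_inf_ge[OF step.hyps(1)]
        by (rule le_trans) (intro phi_closed c D_inf_closed a)+
    qed
  qed
qed

text \<open>Reduces a comparison in the limit to one in \<open>D (Suc n)\<close>. The approximations
  of an element and those of an application are both shown to increase in this way.\<close>

lemma phi_inf_Suc_le:
  assumes "x \<in> carrier (D n)" "y \<in> carrier (D (Suc n))" "phi n x \<sqsubseteq>\<^bsub>D (Suc n)\<^esub> y"
  shows "phi_inf n x \<sqsubseteq>\<^bsub>D_inf\<^esub> phi_inf (Suc n) y"
  using phi_inf_mono[OF phi_closed[OF assms(1)] assms(2,3)] unfolding phi_inf_phi[OF assms(1)] .

section \<open>Increasing sequences and the approximations of an element\<close>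

lemma chain_mono:
  assumes "partial_order L" "\<And>n. c n \<in> carrier L" "\<And>n. c n \<sqsubseteq>\<^bsub>L\<^esub> c (Suc n)"
    and "m \<le> (n :: nat)"
  shows "c m \<sqsubseteq>\<^bsub>L\<^esub> c n"
proof -
  interpret partial_order L by fact
  show ?thesis
    using assms(4)
  proof (induction n rule: dec_induct)
    case base
    show ?case using assms(2) by simp
  next
    case (step n)
    show ?case by (rule le_trans[OF step.IH assms(3)]) (rule assms(2))+
  qed
qed

lemma chain_directed:
  assumes "partial_order L" "\<And>n :: nat. c n \<in> carrier L" "\<And>n. c n \<sqsubseteq>\<^bsub>L\<^esub> c (Suc n)"
  shows "directed L (range c)"
  unfolding directed_def
proof (intro conjI ballI)
  show "range c \<subseteq> carrier L" using assms(2) by blast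
  fix x y assume "x \<in> range c" "y \<in> range c"
  then obtain i j where "x = c i" "y = c j" by blast
  then have "x \<sqsubseteq>\<^bsub>L\<^esub> c (max i j)" "y \<sqsubseteq>\<^bsub>L\<^esub> c (max i j)"
    by (simp_all add: chain_mono[where c = c, OF assms])
  then show "\<exists>z\<in>range c. x \<sqsubseteq>\<^bsub>L\<^esub> z \<and> y \<sqsubseteq>\<^bsub>L\<^esub> z" by blast
qed simp

text \<open>Meant for a single component of a chain in \<open>D_inf\<close>, where the supremum is
  reached after finitely many steps.\<close>

lemma chain_lub_eventually_const:
  assumes "partial_order L" "\<And>n. c n \<in> carrier L" "\<And>n. c n \<sqsubseteq>\<^bsub>L\<^esub> c (Suc n)"
    and "\<And>n. k \<le> n \<Longrightarrow> c n = (v :: 'a)"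
  shows "is_lub L v (range (c :: nat \<Rightarrow> 'a))"
proof (rule is_lubI)
  show "v \<in> carrier L" using assms(2)[of k] assms(4)[of k] by simp
  show "x \<sqsubseteq>\<^bsub>L\<^esub> v" if "x \<in> range c" for x
  proof -
    from that obtain n where "x = c n" by blast
    then show ?thesis
      using chain_mono[where c = c, OF assms(1-3), of n "max k n"] assms(4)[of "max k n"] by simp
  qed
  show "v \<sqsubseteq>\<^bsub>L\<^esub> w" if "\<And>x. x \<in> range c \<Longrightarrow> x \<in> carrier L \<Longrightarrow> x \<sqsubseteq>\<^bsub>L\<^esub> w" for w
    using that[OF rangeI assms(2), of k] assms(4)[of k] by simp
qed

lemma phi_inf_proj_Suc_le:
  assumes "a \<in> carrier D_inf"
  shows "phi_inf n (a n) \<sqsubseteq>\<^bsub>D_inf\<^esub> phi_inf (Suc n) (a (Suc n))"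
  using phi_psi_le[OF D_inf_closed[OF assms, of "Suc n"]] unfolding D_inf_psi[OF assms]
  by (intro phi_inf_Suc_le D_inf_closed assms)

text \<open>Component \<open>m\<close> of the approximation \<open>phi_inf n (a n)\<close> equals
  \<open>a m\<close> as soon as \<open>m \<le> n\<close>, so each component of the supremum is
  attained.\<close>

lemma phi_inf_proj_lub:
  assumes a: "a \<in> carrier D_inf"
  shows "directed D_inf (range (\<lambda>n. phi_inf n (a n)))"
    and "is_lub D_inf a (range (\<lambda>n. phi_inf n (a n)))"
proof -
  have c: "phi_inf n (a n) \<in> carrier D_inf" for n by (intro phi_inf_closed D_inf_closed a)
  show "directed D_inf (range (\<lambda>n. phi_inf n (a n)))"
    by (intro chain_directed D_inf_partial_order c phi_inf_proj_Suc_le a)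
  show "is_lub D_inf a (range (\<lambda>n. phi_inf n (a n)))"
  proof (rule D_inf_is_lubI[OF _ a])
    fix m
    have "is_lub (D m) (a m) (range (\<lambda>n. phi_inf n (a n) m))"
      by (rule chain_lub_eventually_const[where k = m])
        (intro D_partial_order D_inf_closed c D_inf_leD phi_inf_proj_Suc_le phi_inf_proj_nth a | assumption)+
    then show "is_lub (D m) (a m) ((\<lambda>x. x m) ` range (\<lambda>n. phi_inf n (a n)))"
      by (simp add: image_image)
  qed (use c in blast)
qed

section \<open>Application\<close>

text \<open>Since \<open>a (Suc n)\<close> is the projection of \<open>a (Suc (Suc n))\<close>, the
  left side is \<open>phi n (psi n y)\<close> with \<open>y\<close> the value of
  \<open>a (Suc (Suc n))\<close> at \<open>phi n (b n)\<close>. Two uses of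
  \<open>phi_psi_le\<close> remain, for \<open>y\<close> itself and for its argument, as
  \<open>b n\<close> is the projection of \<open>b (Suc n)\<close>.\<close>

lemma app_inf_chain:
  assumes a: "a \<in> carrier D_inf" and b: "b \<in> carrier D_inf"
  shows "phi n (ap (a (Suc n)) (b n)) \<sqsubseteq>\<^bsub>D (Suc n)\<^esub> ap (a (Suc (Suc n))) (b (Suc n))"
proof -
  interpret partial_order "D (Suc n)" by (rule D_partial_order)
  let ?a = "a (Suc (Suc n))"
  have ac: "?a \<in> carrier (D (Suc (Suc n)))" and bc: "\<And>n. b n \<in> carrier (D n)"
    using D_inf_closed[OF a] D_inf_closed[OF b] by blast+
  have "ap (a (Suc n)) (b n) = psi n (ap ?a (phi n (b n)))"
    using ap_psi_Suc[OF bc, of n ?a] unfolding D_inf_psi[OF a] .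
  moreover have "phi n (psi n (ap ?a (phi n (b n)))) \<sqsubseteq>\<^bsub>D (Suc n)\<^esub> ap ?a (phi n (b n))"
    by (intro phi_psi_le ap_closed ac phi_closed bc)
  moreover have "ap ?a (phi n (b n)) \<sqsubseteq>\<^bsub>D (Suc n)\<^esub> ap ?a (b (Suc n))"
    using phi_psi_le[OF bc, of n] unfolding D_inf_psi[OF b]
    by (intro ap_mono ac phi_closed bc)
  moreover have "phi n (psi n (ap ?a (phi n (b n)))) \<in> carrier (D (Suc n))"
    "ap ?a (phi n (b n)) \<in> carrier (D (Suc n))" "ap ?a (b (Suc n)) \<in> carrier (D (Suc n))"
    by (intro phi_closed psi_closed ap_closed ac bc)+
  ultimately show ?thesis using le_trans by metis
qed

lemma app_inf_approx:
  assumes a: "a \<in> carrier D_inf" and b: "b \<in> carrier D_inf"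
  shows "phi_inf n (ap (a (Suc n)) (b n)) \<in> carrier D_inf"
    and "phi_inf n (ap (a (Suc n)) (b n)) \<sqsubseteq>\<^bsub>D_inf\<^esub> phi_inf (Suc n) (ap (a (Suc (Suc n))) (b (Suc n)))"
  by (intro phi_inf_closed phi_inf_Suc_le app_inf_chain ap_closed D_inf_closed a b)+

text \<open>The supremum in \<open>app_inf\<close> is a choice term; directedness of the
  approximations provides the least upper bound that it needs.\<close>

lemma app_inf_lub:
  assumes a: "a \<in> carrier D_inf" and b: "b \<in> carrier D_inf"
  shows "is_lub D_inf (app_inf a b) (range (\<lambda>n. phi_inf n (ap (a (Suc n)) (b n))))"
proof -
  have "directed D_inf (range (\<lambda>n. phi_inf n (ap (a (Suc n)) (b n))))"
    by (intro chain_directed D_inf_partial_order app_inf_approx a b)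
  then have "\<exists>u. is_lub D_inf u (range (\<lambda>n. phi_inf n (ap (a (Suc n)) (b n))))"
    using D_inf_directed_lub by blast
  then show ?thesis unfolding app_inf_def sup_def by (rule someI_ex)
qed

lemma app_inf_closed:
  assumes "a \<in> carrier D_inf" "b \<in> carrier D_inf" shows "app_inf a b \<in> carrier D_inf"
  by (rule is_lubD(1)[OF app_inf_lub[OF assms]]) (use app_inf_approx(1)[OF assms] in blast)

text \<open>Each approximation is a projection, followed by evaluation at \<open>b n\<close> and an
  embedding.\<close>

lemma scott_continuous_app_inf_left:
  assumes b: "b \<in> carrier D_inf"
  shows "scott_continuous D_inf D_inf (\<lambda>a. app_inf a b)"
proof (rule scott_continuous_Sup[OF D_inf_partial_order D_inf_partial_order])
  show "is_lub D_inf (app_inf a b) (range (\<lambda>n. phi_inf n (ap (a (Suc n)) (b n))))"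
    if "a \<in> carrier D_inf" for a using app_inf_lub[OF that b] .
  fix n
  have "scott_continuous (D (Suc n)) (D n) (\<lambda>x. ap x (b n))"
    using scott_continuous_eval[OF D_cpo D_small D_inf_closed[OF b]] by simp
  from scott_continuous_comp[OF D_inf_partial_order
      scott_continuous_comp[OF D_inf_partial_order scott_continuous_proj this] scott_continuous_phi_inf]
  show "scott_continuous D_inf D_inf (\<lambda>a. phi_inf n (ap (a (Suc n)) (b n)))" .
qed

lemma scott_continuous_app_inf_right:
  assumes a: "a \<in> carrier D_inf"
  shows "scott_continuous D_inf D_inf (app_inf a)"
proof (rule scott_continuous_Sup[OF D_inf_partial_order D_inf_partial_order])
  show "is_lub D_inf (app_inf a b) (range (\<lambda>n. phi_inf n (ap (a (Suc n)) (b n))))"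
    if "b \<in> carrier D_inf" for b using app_inf_lub[OF a that] .
  fix n
  from scott_continuous_comp[OF D_inf_partial_order
      scott_continuous_comp[OF D_inf_partial_order scott_continuous_proj
        scott_continuous_ap[OF D_inf_closed[OF a]]] scott_continuous_phi_inf]
  show "scott_continuous D_inf D_inf (\<lambda>b. phi_inf n (ap (a (Suc n)) (b n)))" .
qed

text \<open>The descent from stage \<open>Suc n\<close> to a component \<open>m \<le> n\<close>
  begins with \<open>psi n\<close>.\<close>

lemma phi_inf_psi: "m \<le> n \<Longrightarrow> phi_inf (Suc n) x m = phi_inf n (psi n x) m"
  by (induction m rule: inc_induct) (simp_all add: phi_inf_less phi_inf_self)

text \<open>Component \<open>n\<close> of the approximations is constant from stage \<open>n\<close>
  on, so no limit is left. This recovers \<open>a (Suc n)\<close> from the applicative behaviour of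
  \<open>a\<close>.\<close>

lemma app_inf_phi_inf_nth:
  assumes a: "a \<in> carrier D_inf" and x: "x \<in> carrier (D n)"
  shows "app_inf a (phi_inf n x) n = ap (a (Suc n)) x"
proof -
  let ?b = "phi_inf n x"
  let ?c = "\<lambda>k. ap (a (Suc k)) (?b k)"
  have b: "?b \<in> carrier D_inf" using phi_inf_closed[OF x] .
  have const: "phi_inf k (?c k) n = ap (a (Suc n)) x" if "n \<le> k" for k
    using that
  proof (induction k rule: dec_induct)
    case base
    show ?case by (simp add: phi_inf_self)
  next
    case (step k)
    \<comment> \<open>From \<open>n\<close> on, \<open>?b (Suc k)\<close> is exactly
      \<open>phi k (?b k)\<close>, so projecting gives equality.\<close>
    have "psi k (?c (Suc k)) = ?c k"
      using ap_psi_Suc[OF D_inf_closed[OF b], of k "a (Suc (Suc k))"] step.hyps(1)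
      unfolding D_inf_psi[OF a] by (simp only: phi_inf_ge)
    then show ?case using step.IH phi_inf_psi[OF step.hyps(1)] by simp
  qed
  have "is_lub (D n) (ap (a (Suc n)) x) (range (\<lambda>k. phi_inf k (?c k) n))"
    by (rule chain_lub_eventually_const[where k = n])
      (intro D_partial_order D_inf_closed app_inf_approx D_inf_leD a b const | assumption)+
  moreover have "is_lub (D n) (app_inf a ?b n) ((\<lambda>d. d n) ` range (\<lambda>k. phi_inf k (?c k)))"
    by (rule scott_continuous_lub[OF scott_continuous_proj _ app_inf_lub[OF a b]])
      (intro chain_directed D_inf_partial_order app_inf_approx a b)
  ultimately show ?thesis
    using is_lub_unique[OF D_partial_order] by (simp add: image_image)
qed

text \<open>Testing on the embedded elements \<open>phi_inf n x\<close> compares the components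
  \<open>Suc n\<close> pointwise.\<close>

lemma app_inf_extensional:
  assumes a: "a \<in> carrier D_inf" and a': "a' \<in> carrier D_inf"
    and le: "\<And>b. b \<in> carrier D_inf \<Longrightarrow> app_inf a b \<sqsubseteq>\<^bsub>D_inf\<^esub> app_inf a' b"
  shows "a \<sqsubseteq>\<^bsub>D_inf\<^esub> a'"
  unfolding D_inf_le_iff
proof
  fix n
  have "a (Suc n) \<sqsubseteq>\<^bsub>D (Suc n)\<^esub> a' (Suc n)"
    unfolding D.simps fun_space_le
  proof
    fix x assume x: "x \<in> carrier (D n)"
    show "ap (a (Suc n)) x \<sqsubseteq>\<^bsub>D n\<^esub> ap (a' (Suc n)) x"
      using D_inf_leD[OF le[OF phi_inf_closed[OF x]], of n]
      unfolding app_inf_phi_inf_nth[OF a x] app_inf_phi_inf_nth[OF a' x] .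
  qed
  \<comment> \<open>Projecting down from \<open>Suc n\<close> also reaches component
    \<open>0\<close>, which is not a function.\<close>
  from psi_mono[OF D_inf_closed[OF a] D_inf_closed[OF a'] this]
  show "a n \<sqsubseteq>\<^bsub>D n\<^esub> a' n" unfolding D_inf_psi[OF a] D_inf_psi[OF a'] .
qed

text \<open>
  The argument of \<open>\<psi>\<^sub>n\<close> is the component \<open>n + 1\<close>; projecting it also covers the component \<open>0\<close>.
\<close>

definition lam_inf :: "((nat \<Rightarrow> scott) \<Rightarrow> nat \<Rightarrow> scott) \<Rightarrow> nat \<Rightarrow> scott" where
  "lam_inf f n = psi n (fn (carrier (D n)) (\<lambda>x. f (phi_inf n x) n))"

text \<open>By continuity \<open>f b\<close> is the supremum of the
  \<open>f (phi_inf n (b n))\<close>. Truncating each of these at its own stage \<open>n\<close>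
  leaves a diagonal with the same supremum, and that diagonal is the sequence defining the
  application.\<close>

lemma
  assumes f: "scott_continuous D_inf D_inf f"
  shows lam_inf_closed: "lam_inf f \<in> carrier D_inf"
    and app_inf_lam_inf: "b \<in> carrier D_inf \<Longrightarrow> app_inf (lam_inf f) b = f b"
proof -
  \<comment> \<open>\<open>g n\<close> is to be component \<open>Suc n\<close> of the representing
    element.\<close>
  define g where "g n = fn (carrier (D n)) (\<lambda>x. f (phi_inf n x) n)" for n
  note fc = scott_continuous_car[OF f]
  note f_mono = scott_continuous_mono[OF D_inf_partial_order f]
  have "scott_continuous (D n) (D n) (\<lambda>x. f (phi_inf n x) n)" for n
    by (rule scott_continuous_comp[OF D_partial_order
          scott_continuous_comp[OF D_partial_order scott_continuous_phi_inf f] scott_continuous_proj])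
  then have gc: "g n \<in> carrier (D (Suc n))" for n
    unfolding g_def D.simps by (rule fun_space_memI)
  have ap_g: "ap (g n) x = f (phi_inf n x) n" if "x \<in> carrier (D n)" for n x
    unfolding g_def by (rule ap_fn[OF D_small that])
  have psi_g: "psi (Suc n) (g (Suc n)) = g n" for n
  proof (rule fun_space_eqI[OF D_small])
    show "psi (Suc n) (g (Suc n)) \<in> carrier (fun_space (D n))" "g n \<in> carrier (fun_space (D n))"
      using psi_closed[OF gc, of "Suc n"] gc[of n] by simp_all
    fix x assume x: "x \<in> carrier (D n)"
    show "ap (psi (Suc n) (g (Suc n))) x = ap (g n) x"
      unfolding ap_psi_Suc[OF x] ap_g[OF x] ap_g[OF phi_closed[OF x]] phi_inf_phi[OF x]
      by (rule D_inf_psi[OF fc[OF phi_inf_closed[OF x]]])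
  qed
  have lam: "lam_inf f n = psi n (g n)" for n by (simp add: lam_inf_def g_def)
  have lam_Suc: "lam_inf f (Suc n) = g n" for n unfolding lam by (rule psi_g)
  show lamc: "lam_inf f \<in> carrier D_inf"
    unfolding D_inf_mem_iff lam_Suc using psi_closed[OF gc] lam by simp
  show "app_inf (lam_inf f) b = f b" if b: "b \<in> carrier D_inf"
  proof (rule is_lub_unique[OF D_inf_partial_order app_inf_lub[OF lamc b]])
    let ?b = "\<lambda>n. phi_inf n (b n)"
    have bc: "?b n \<in> carrier D_inf" for n by (intro phi_inf_closed D_inf_closed b)
    have b_mono: "?b m \<sqsubseteq>\<^bsub>D_inf\<^esub> ?b n" if "m \<le> n" for m n
      by (rule chain_mono[where c = ?b, OF D_inf_partial_order bc phi_inf_proj_Suc_le[OF b] that])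
    have eq: "phi_inf n (ap (lam_inf f (Suc n)) (b n)) = phi_inf n (f (?b n) n)" for n
      by (simp add: lam_Suc ap_g D_inf_closed[OF b])
    have approx_closed: "phi_inf n (f (?b n) n) \<in> carrier D_inf" for n
      by (rule phi_inf_closed[OF D_inf_closed[OF fc[OF bc]]])
    interpret partial_order D_inf by (rule D_inf_partial_order)
    show "is_lub D_inf (f b) (range (\<lambda>n. phi_inf n (ap (lam_inf f (Suc n)) (b n))))"
      unfolding eq
    proof (rule is_lubI)
      show "f b \<in> carrier D_inf" using fc[OF b] .
      fix y assume "y \<in> range (\<lambda>n. phi_inf n (f (?b n) n))"
      then obtain n where y: "y = phi_inf n (f (?b n) n)" by blast
      have "y \<sqsubseteq>\<^bsub>D_inf\<^esub> f (?b n)" unfolding y by (rule phi_inf_proj_le[OF fc[OF bc]])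
      moreover have "f (?b n) \<sqsubseteq>\<^bsub>D_inf\<^esub> f b" by (rule f_mono[OF bc b phi_inf_proj_le[OF b]])
      ultimately show "y \<sqsubseteq>\<^bsub>D_inf\<^esub> f b"
        by (rule le_trans) (use approx_closed y fc bc b in blast)+
    next
      fix v assume v: "v \<in> carrier D_inf"
        "\<And>y. y \<in> range (\<lambda>n. phi_inf n (f (?b n) n)) \<Longrightarrow> y \<in> carrier D_inf \<Longrightarrow> y \<sqsubseteq>\<^bsub>D_inf\<^esub> v"
      show "f b \<sqsubseteq>\<^bsub>D_inf\<^esub> v"
      \<comment> \<open>Continuity of \<open>f\<close> reduces the bound to the approximations of
        \<open>b\<close>.\<close>
      proof (rule scott_continuous_le[OF f phi_inf_proj_lub[OF b] v(1)])
        fix y assume "y \<in> range ?b"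
        then obtain n where y: "y = ?b n" by blast
        show "f y \<sqsubseteq>\<^bsub>D_inf\<^esub> v"
          unfolding y D_inf_le_iff
        proof
          fix m
          \<comment> \<open>Stage \<open>?k\<close> is late enough for \<open>?b ?k\<close> to lie
            above \<open>?b n\<close> and for truncation to leave component \<open>m\<close>
            unchanged.\<close>
          let ?k = "max m n"
          interpret Dm: partial_order "D m" by (rule D_partial_order)
          have "f (?b n) m \<sqsubseteq>\<^bsub>D m\<^esub> f (?b ?k) m"
            by (intro D_inf_leD f_mono bc b_mono) simp
          moreover have "f (?b ?k) m = phi_inf ?k (f (?b ?k) ?k) m"
            using phi_inf_proj_nth[OF fc[OF bc]] by simp
          moreover have "phi_inf ?k (f (?b ?k) ?k) m \<sqsubseteq>\<^bsub>D m\<^esub> v m"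
            by (rule D_inf_leD[OF v(2)[OF rangeI approx_closed]])
          moreover have "f (?b n) m \<in> carrier (D m)" "f (?b ?k) m \<in> carrier (D m)" "v m \<in> carrier (D m)"
            by (rule D_inf_closed[OF fc[OF bc]] D_inf_closed[OF v(1)])+
          ultimately show "f (?b n) m \<sqsubseteq>\<^bsub>D m\<^esub> v m" using Dm.le_trans by metis
        qed
      qed
    qed
  qed
qed

lemma D_inf_two_elements: "\<exists>a\<in>carrier D_inf. \<exists>b\<in>carrier D_inf. a \<noteq> b"
proof (intro bexI)
  show "phi_inf 0 (Num 0) \<noteq> phi_inf 0 (Num 1)"
    using phi_inf_self[of 0 "Num 0"] phi_inf_self[of 0 "Num 1"] by auto
  show "phi_inf 0 (Num 0) \<in> carrier D_inf" "phi_inf 0 (Num 1) \<in> carrier D_inf"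
    by (simp_all add: phi_inf_closed flat_nat_def)
qed

section \<open>\<open>\<lambda>\<close>-models from extensional reflexive c.p.o.s\<close>

text \<open>\<open>lam\<close> picks a representing element for each continuous function, and
  extensionality makes this element unique. Stating extensionality for the order lets it yield
  monotonicity of abstraction as well.\<close>

locale extensional_reflexive_cpo =
  fixes L :: "('a, 'b) gorder_scheme"
    and app :: "'a \<Rightarrow> 'a \<Rightarrow> 'a"
    and lam :: "('a \<Rightarrow> 'a) \<Rightarrow> 'a"
  assumes partial_order: "partial_order L"
    and directed_lub: "directed L X \<Longrightarrow> \<exists>u. is_lub L u X"
    and two_elements: "\<exists>a\<in>carrier L. \<exists>b\<in>carrier L. a \<noteq> b"
    and app_left: "b \<in> carrier L \<Longrightarrow> scott_continuous L L (\<lambda>a. app a b)"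
    and app_right: "a \<in> carrier L \<Longrightarrow> scott_continuous L L (app a)"
    and app_ext_le: "a \<in> carrier L \<Longrightarrow> a' \<in> carrier L \<Longrightarrow>
      (\<And>b. b \<in> carrier L \<Longrightarrow> app a b \<sqsubseteq>\<^bsub>L\<^esub> app a' b) \<Longrightarrow> a \<sqsubseteq>\<^bsub>L\<^esub> a'"
    and lam_closed: "scott_continuous L L f \<Longrightarrow> lam f \<in> carrier L"
    and app_lam: "scott_continuous L L f \<Longrightarrow> b \<in> carrier L \<Longrightarrow> app (lam f) b = f b"
begin

sublocale partial_order L by (rule partial_order)

lemma app_closed: "a \<in> carrier L \<Longrightarrow> b \<in> carrier L \<Longrightarrow> app a b \<in> carrier L"
  by (rule scott_continuous_car[OF app_right])

lemma app_ext:
  assumes "a \<in> carrier L" "a' \<in> carrier L" "\<And>b. b \<in> carrier L \<Longrightarrow> app a b = app a' b"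
  shows "a = a'"
proof (rule le_antisym)
  show "a \<sqsubseteq>\<^bsub>L\<^esub> a'" "a' \<sqsubseteq>\<^bsub>L\<^esub> a"
    by (rule app_ext_le; use assms app_closed in simp)+
qed (rule assms)+

text \<open>Abstraction does not see values outside the carrier, because application to members of
  the carrier determines the result.\<close>

lemma lam_cong:
  assumes "scott_continuous L L f" "\<And>b. b \<in> carrier L \<Longrightarrow> f b = g b"
  shows "lam f = lam g"
proof -
  have "scott_continuous L L g" using assms by (rule scott_continuous_cong)
  with assms show ?thesis by - (rule app_ext[OF lam_closed lam_closed]; simp add: app_lam)
qed

text \<open>
  Continuity of abstraction need not be assumed: extensionality reduces it to the continuity of
  application in the first argument.
\<close>

lemma scott_continuous_lam:
  assumes g1: "\<And>d. d \<in> carrier L \<Longrightarrow> scott_continuous L L (g d)"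
    and g2: "\<And>e. e \<in> carrier L \<Longrightarrow> scott_continuous L L (\<lambda>d. g d e)"
  shows "scott_continuous L L (\<lambda>d. lam (g d))"
proof (rule scott_continuousI)
  show lamc: "lam (g d) \<in> carrier L" if "d \<in> carrier L" for d
    by (rule lam_closed[OF g1[OF that]])
  fix X u assume X: "directed L X" "is_lub L u X" "u \<in> carrier L"
  note Xs = directed_subset[OF X(1)]
  have mono: "lam (g x) \<sqsubseteq>\<^bsub>L\<^esub> lam (g y)"
    if "x \<in> carrier L" "y \<in> carrier L" "x \<sqsubseteq>\<^bsub>L\<^esub> y" for x y
    using scott_continuous_mono[OF partial_order g2 that] that(1,2)
    by - (rule app_ext_le[OF lamc lamc]; simp add: app_lam g1)
  have dir: "directed L ((\<lambda>d. lam (g d)) ` X)"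
    unfolding directed_def
  proof (intro conjI ballI)
    show "(\<lambda>d. lam (g d)) ` X \<subseteq> carrier L" using Xs lamc by blast
    show "(\<lambda>d. lam (g d)) ` X \<noteq> {}" using X(1) by (auto simp: directed_def)
    fix a b assume "a \<in> (\<lambda>d. lam (g d)) ` X" "b \<in> (\<lambda>d. lam (g d)) ` X"
    then obtain x y where xy: "x \<in> X" "y \<in> X" "a = lam (g x)" "b = lam (g y)" by blast
    then obtain z where z: "z \<in> X" "x \<sqsubseteq>\<^bsub>L\<^esub> z" "y \<sqsubseteq>\<^bsub>L\<^esub> z"
      using X(1) unfolding directed_def by blast
    have "a \<sqsubseteq>\<^bsub>L\<^esub> lam (g z)" "b \<sqsubseteq>\<^bsub>L\<^esub> lam (g z)"
      unfolding xy(3,4) by (rule mono[OF _ _ z(2)] mono[OF _ _ z(3)]; rule subsetD[OF Xs]; fact)+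
    then show "\<exists>z\<in>(\<lambda>d. lam (g d)) ` X. a \<sqsubseteq>\<^bsub>L\<^esub> z \<and> b \<sqsubseteq>\<^bsub>L\<^esub> z" using z(1) by blast
  qed
  then obtain w where w: "is_lub L w ((\<lambda>d. lam (g d)) ` X)" using directed_lub by blast
  \<comment> \<open>Applied to \<open>e\<close>, both sides become the supremum of the values
    \<open>g d e\<close>: the left by \<open>g2\<close>, the right by continuity of
    \<open>app\<close> in its first argument.\<close>
  have "lam (g u) = w"
  proof (rule app_ext[OF lamc[OF X(3)]])
    show "w \<in> carrier L" using is_lubD(1)[OF w directed_subset[OF dir]] .
    fix e assume e: "e \<in> carrier L"
    have "is_lub L (app w e) ((\<lambda>a. app a e) ` (\<lambda>d. lam (g d)) ` X)"
      by (rule scott_continuous_lub[OF app_left[OF e] dir w])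
    moreover have "(\<lambda>a. app a e) ` (\<lambda>d. lam (g d)) ` X = (\<lambda>d. g d e) ` X"
      unfolding image_image using Xs e by (intro image_cong) (auto simp: app_lam g1)
    moreover have "is_lub L (g u e) ((\<lambda>d. g d e) ` X)"
      by (rule scott_continuous_lub[OF g2[OF e] X(1,2)])
    ultimately have "app w e = g u e" using is_lub_unique[OF partial_order] by simp
    then show "app (lam (g u)) e = app w e" using app_lam[OF g1[OF X(3)] e] by simp
  qed
  then show "is_lub L (lam (g u)) ((\<lambda>d. lam (g d)) ` X)" using w by simp
qed

section \<open>Interpretation of terms and the substitution lemma\<close>

primrec interp :: "lterm \<Rightarrow> (nat \<Rightarrow> 'a) \<Rightarrow> 'a" where
  "interp (Var x) \<rho> = \<rho> x"
| "interp (App P Q) \<rho> = app (interp P \<rho>) (interp Q \<rho>)"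
| "interp (Lam x P) \<rho> = lam (\<lambda>d. interp P (\<rho>(x := d)))"

text \<open>The abstraction clause is meaningful only through this, since \<open>lam\<close> is
  specified on continuous functions. Generalising over \<open>\<rho>\<close> and \<open>x\<close>
  lets the abstraction case vary either the bound variable or the outer one.\<close>

lemma scott_continuous_interp:
  "range \<rho> \<subseteq> carrier L \<Longrightarrow> scott_continuous L L (\<lambda>d. interp M (\<rho>(x := d)))"
proof (induction M arbitrary: \<rho> x)
  case (Var y)
  then have "\<rho> y \<in> carrier L" by (simp add: image_subset_iff)
  then show ?case
    by (cases "y = x") (simp_all add: scott_continuous_id scott_continuous_const[OF partial_order])
next
  case (App P Q)
  show ?case
    unfolding interp.simps
    using scott_continuous_binop[OF partial_order partial_order partial_order partial_order
        app_left app_right App.IH(1)[OF App.prems] App.IH(2)[OF App.prems]] .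
next
  case (Lam y P)
  show ?case
  proof (cases "y = x")
    case True
    show ?thesis
      unfolding True interp.simps fun_upd_upd
      by (rule scott_continuous_const[OF partial_order lam_closed[OF Lam.IH[OF Lam.prems]]])
  next
    case False
    have upd: "range (\<rho>(z := d)) \<subseteq> carrier L" if "d \<in> carrier L" for z d
      using Lam.prems that by (auto simp: image_subset_iff)
    show ?thesis
      unfolding interp.simps
    proof (rule scott_continuous_lam)
      show "scott_continuous L L (\<lambda>e. interp P (\<rho>(x := d, y := e)))" if "d \<in> carrier L" for d
        by (rule Lam.IH[OF upd[OF that]])
      \<comment> \<open>Updates at distinct variables commute, so the update at \<open>x\<close> can
        be made last and the induction hypothesis applies.\<close>
      show "scott_continuous L L (\<lambda>d. interp P (\<rho>(x := d, y := e)))" if "e \<in> carrier L" for e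
        unfolding fun_upd_twist[OF False[symmetric]] by (rule Lam.IH[OF upd[OF that]])
    qed
  qed
qed

text \<open>Reassigning a variable its own value changes nothing, so the interpretation is a value
  of a continuous map.\<close>

lemma interp_closed: "range \<rho> \<subseteq> carrier L \<Longrightarrow> interp M \<rho> \<in> carrier L"
  using scott_continuous_car[OF scott_continuous_interp[of \<rho> M undefined], of "\<rho> undefined"]
  by (auto simp: image_subset_iff)

lemma interp_FV_cong:
  assumes "range \<rho> \<subseteq> carrier L" "range \<sigma> \<subseteq> carrier L" "\<And>v. v \<in> FV M \<Longrightarrow> \<rho> v = \<sigma> v"
  shows "interp M \<rho> = interp M \<sigma>"
  using assms
proof (induction M arbitrary: \<rho> \<sigma>)
  case (App P Q)
  have "interp P \<rho> = interp P \<sigma>" "interp Q \<rho> = interp Q \<sigma>"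
    using App.prems by (auto intro: App.IH)
  then show ?case by simp
next
  case (Lam x P)
  show ?case
    unfolding interp.simps
  proof (rule lam_cong[OF scott_continuous_interp[OF Lam.prems(1)]])
    fix d assume "d \<in> carrier L"
    then show "interp P (\<rho>(x := d)) = interp P (\<sigma>(x := d))"
      using Lam.prems by (intro Lam.IH) (auto simp: image_subset_iff)
  qed
qed simp

lemma finite_FV: "finite (FV M)"
  by (induction M) simp_all

text \<open>Generalising over the substitution absorbs the renaming of bound variables: the new
  binder is just another entry of \<open>s\<close>.\<close>

lemma interp_psubst:
  "range \<rho> \<subseteq> carrier L \<Longrightarrow> interp (psubst M s) \<rho> = interp M (\<lambda>v. interp (s v) \<rho>)"
proof (induction M arbitrary: s \<rho>)
  case (Lam x P)
  define V where "V = (\<Union>v\<in>FV P - {x}. FV (s v))"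
  define z where "z = (if x \<in> V then LEAST z. z \<notin> V else x)"
  \<comment> \<open>Finiteness of \<open>V\<close> guarantees a fresh name, so \<open>z\<close>
    avoids capture in both branches of its definition.\<close>
  have "finite V" unfolding V_def by (simp add: finite_FV)
  then have "\<exists>z. z \<notin> V" using ex_new_if_finite[OF infinite_UNIV_nat] by blast
  from LeastI_ex[OF this] have z: "z \<notin> V" by (simp add: z_def)
  have "interp (psubst (Lam x P) s) \<rho> = lam (\<lambda>d. interp (psubst P (s(x := Var z))) (\<rho>(z := d)))"
    by (simp add: Let_def flip: V_def z_def)
  also have "\<dots> = lam (\<lambda>d. interp P ((\<lambda>v. interp (s v) \<rho>)(x := d)))"
  proof (rule lam_cong[OF scott_continuous_interp[OF Lam.prems]])
    fix d assume d: "d \<in> carrier L"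
    have r: "range (\<rho>(z := d)) \<subseteq> carrier L" using Lam.prems d by (auto simp: image_subset_iff)
    have "interp (psubst P (s(x := Var z))) (\<rho>(z := d))
        = interp P (\<lambda>v. interp ((s(x := Var z)) v) (\<rho>(z := d)))"
      by (rule Lam.IH[OF r])
    also have "\<dots> = interp P ((\<lambda>v. interp (s v) \<rho>)(x := d))"
    proof (rule interp_FV_cong)
      show "range (\<lambda>v. interp ((s(x := Var z)) v) (\<rho>(z := d))) \<subseteq> carrier L"
        using interp_closed[OF r] by blast
      show "range ((\<lambda>v. interp (s v) \<rho>)(x := d)) \<subseteq> carrier L"
        using interp_closed[OF Lam.prems] d by (auto simp: image_subset_iff)
      fix v assume v: "v \<in> FV P"
      \<comment> \<open>Here \<open>v\<close> is free in \<open>P\<close> and differs from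
        \<open>x\<close>, so the free variables of \<open>s v\<close> lie in \<open>V\<close>, which
        \<open>z\<close> avoids.\<close>
      have "interp (s v) (\<rho>(z := d)) = interp (s v) \<rho>" if "v \<noteq> x"
        by (rule interp_FV_cong[OF r Lam.prems]) (use v that z in \<open>auto simp: V_def\<close>)
      then show "interp ((s(x := Var z)) v) (\<rho>(z := d)) = ((\<lambda>v. interp (s v) \<rho>)(x := d)) v"
        by simp
    qed
    finally show "interp (psubst P (s(x := Var z))) (\<rho>(z := d))
      = interp P ((\<lambda>v. interp (s v) \<rho>)(x := d))" .
  qed
  finally show ?case by simp
qed simp_all

theorem extensional_lambda_model: "extensional_lambda_model (carrier L) app interp"
proof
  fix \<rho> :: "nat \<Rightarrow> 'a" and M P Q :: lterm and x y :: nat and d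
  show "applicative_structure (carrier L) app"
    by (simp add: applicative_structure_def app_closed)
  assume r: "range \<rho> \<subseteq> carrier L"
  then have upd: "range (\<rho>(x := d)) \<subseteq> carrier L" if "d \<in> carrier L" for x d
    using that by (auto simp: image_subset_iff)
  show "interp M \<rho> \<in> carrier L" by (rule interp_closed[OF r])
  show "interp M \<rho> = interp M \<sigma>"
    if "range \<sigma> \<subseteq> carrier L" "\<And>x. x \<in> FV M \<Longrightarrow> \<rho> x = \<sigma> x" for \<sigma>
    using r that by (rule interp_FV_cong)
  show "app (interp (Lam x P) \<rho>) d = interp P (\<rho>(x := d))" if "d \<in> carrier L"
    using app_lam[OF scott_continuous_interp[OF r] that] by simp
  show "interp (Lam x P) \<rho> = interp (Lam x Q) \<rho>"
    if "\<And>d. d \<in> carrier L \<Longrightarrow> interp P (\<rho>(x := d)) = interp Q (\<rho>(x := d))"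
    unfolding interp.simps using lam_cong[OF scott_continuous_interp[OF r] that] .
  show "interp (Lam x M) \<rho> = interp (Lam y ([Var y/x]M)) \<rho>" if y: "y \<notin> FV M"
    unfolding interp.simps
  proof (rule lam_cong[OF scott_continuous_interp[OF r]])
    fix d assume d: "d \<in> carrier L"
    have "interp ([Var y/x]M) (\<rho>(y := d)) = interp M (\<lambda>v. interp ((Var(x := Var y)) v) (\<rho>(y := d)))"
      unfolding subst_def by (rule interp_psubst[OF upd[OF d]])
    also have "\<dots> = interp M (\<rho>(x := d))"
    \<comment> \<open>The two assignments can differ only at \<open>y\<close>, which is not free in
      \<open>M\<close>, apart from \<open>x\<close>, where both give \<open>d\<close>.\<close>
    proof (rule interp_FV_cong[OF _ upd[OF d]])
      show "range (\<lambda>v. interp ((Var(x := Var y)) v) (\<rho>(y := d))) \<subseteq> carrier L"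
        using interp_closed[OF upd[OF d]] by blast
    qed (use y in auto)
    finally show "interp M (\<rho>(x := d)) = interp ([Var y/x]M) (\<rho>(y := d))" by simp
  qed
  show "interp (Lam x (App M (Var x))) \<rho> = interp M \<rho>" if x: "x \<notin> FV M"
  proof (rule app_ext)
    show "interp (Lam x (App M (Var x))) \<rho> \<in> carrier L" "interp M \<rho> \<in> carrier L"
      by (rule interp_closed[OF r])+
    fix d assume d: "d \<in> carrier L"
    have "app (interp (Lam x (App M (Var x))) \<rho>) d = interp (App M (Var x)) (\<rho>(x := d))"
      using app_lam[OF scott_continuous_interp[OF r, of "App M (Var x)" x] d] by simp
    moreover have "interp M (\<rho>(x := d)) = interp M \<rho>"
      by (rule interp_FV_cong[OF upd[OF d] r]) (use x in auto)
    ultimately show "app (interp (Lam x (App M (Var x))) \<rho>) d = app (interp M \<rho>) d" by simp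
  qed
qed (simp_all add: two_elements)

end

text \<open>Assignments are pulled back along the inverse of \<open>h\<close>, and values are pushed
  forward along \<open>h\<close>.\<close>

lemma extensional_lambda_model_transfer:
  assumes "extensional_lambda_model A f interp" and iso: "applicative_iso A f B g h"
  shows "extensional_lambda_model B g (\<lambda>M \<rho>. h (interp M (inv_into A h \<circ> \<rho>)))"
proof -
  interpret A: extensional_lambda_model A f interp by fact
  let ?k = "inv_into A h"
  have bij: "bij_betw h A B" and app: "applicative_structure B g"
    and hom: "\<And>a b. a \<in> A \<Longrightarrow> b \<in> A \<Longrightarrow> h (f a b) = g (h a) (h b)"
    using iso by (auto simp: applicative_iso_def)
  have hB: "h a \<in> B" if "a \<in> A" for a using bij_betwE[OF bij] that by blast
  have kA: "?k b \<in> A" if "b \<in> B" for b using bij_betwE[OF bij_betw_inv_into[OF bij]] that by blast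
  have hk: "h (?k b) = b" if "b \<in> B" for b by (rule bij_betw_inv_into_right[OF bij that])
  have inj: "a = b" if "h a = h b" "a \<in> A" "b \<in> A" for a b
    using bij_betw_imp_inj_on[OF bij] that by (auto dest: inj_onD)
  have r: "range (?k \<circ> \<rho>) \<subseteq> A" if "range \<rho> \<subseteq> B" for \<rho> :: "nat \<Rightarrow> 'b"
    using that kA by (auto simp: image_subset_iff)
  have upd: "?k \<circ> \<rho>(x := d) = (?k \<circ> \<rho>)(x := ?k d)" for \<rho> :: "nat \<Rightarrow> 'b" and x d
    by (rule fun_upd_comp)
  have updA: "(?k \<circ> \<rho>)(x := a) = ?k \<circ> \<rho>(x := h a)" if "a \<in> A" for \<rho> :: "nat \<Rightarrow> 'b" and x a
    using bij_betw_inv_into_left[OF bij that] by (simp add: upd)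
  show ?thesis
  proof
    show "\<exists>a\<in>B. \<exists>b\<in>B. a \<noteq> b" using A.two_elements hB inj by metis
    show "applicative_structure B g" by (rule app)
    fix \<rho> :: "nat \<Rightarrow> 'b" and M P Q :: lterm and x y :: nat and d
    assume \<rho>: "range \<rho> \<subseteq> B"
    note r\<rho> = r[OF \<rho>]
    note closed = A.interp_closed[OF r\<rho>]
    show "h (interp M (?k \<circ> \<rho>)) \<in> B" by (rule hB[OF closed])
    show "h (interp (Var x) (?k \<circ> \<rho>)) = \<rho> x"
      using hk \<rho> by (simp add: A.interp_Var[OF r\<rho>] image_subset_iff)
    show "h (interp (App P Q) (?k \<circ> \<rho>)) = g (h (interp P (?k \<circ> \<rho>))) (h (interp Q (?k \<circ> \<rho>)))"
      by (simp add: A.interp_App[OF r\<rho>] hom closed)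
    show "g (h (interp (Lam x P) (?k \<circ> \<rho>))) d = h (interp P (?k \<circ> \<rho>(x := d)))" if "d \<in> B"
      using hom[OF closed kA[OF that], of "Lam x P"] A.interp_Lam[OF r\<rho> kA[OF that]]
      by (simp add: hk[OF that] upd)
    show "h (interp M (?k \<circ> \<rho>)) = h (interp M (?k \<circ> \<sigma>))"
      if "range \<sigma> \<subseteq> B" "\<And>x. x \<in> FV M \<Longrightarrow> \<rho> x = \<sigma> x" for \<sigma>
      using A.interp_FV[OF r\<rho> r[OF that(1)], of M] that(2) by simp
    show "h (interp (Lam x M) (?k \<circ> \<rho>)) = h (interp (Lam y ([Var y/x]M)) (?k \<circ> \<rho>))"
      if "y \<notin> FV M"
      using A.interp_alpha[OF r\<rho> that] by simp
    show "h (interp (Lam x P) (?k \<circ> \<rho>)) = h (interp (Lam x Q) (?k \<circ> \<rho>))"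
      if eq: "\<And>d. d \<in> B \<Longrightarrow> h (interp P (?k \<circ> \<rho>(x := d))) = h (interp Q (?k \<circ> \<rho>(x := d)))"
    proof (rule arg_cong[OF A.interp_xi[OF r\<rho>]])
      \<comment> \<open>The hypothesis speaks of elements of \<open>B\<close>; it is used at
        \<open>h a\<close>, and injectivity of \<open>h\<close> removes the outer
        \<open>h\<close>.\<close>
      fix a assume a: "a \<in> A"
      have "range (\<rho>(x := h a)) \<subseteq> B" using \<rho> hB[OF a] by (auto simp: image_subset_iff)
      from inj[OF eq[OF hB[OF a]] A.interp_closed[OF r[OF this]] A.interp_closed[OF r[OF this]]]
      show "interp P ((?k \<circ> \<rho>)(x := a)) = interp Q ((?k \<circ> \<rho>)(x := a))"
        unfolding updA[OF a] .
    qed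
    show "h (interp (Lam x (App M (Var x))) (?k \<circ> \<rho>)) = h (interp M (?k \<circ> \<rho>))" if "x \<notin> FV M"
      using A.interp_eta[OF r\<rho> that] by simp
  qed
qed

section \<open>The homotopy groups\<close>

lemma applicative_iso_hpi:
  "applicative_iso (carrier D_inf) app_inf DD_inf DD_inf_app (\<lambda>d n. hpi D_inf_top n d)"
    (is "applicative_iso _ _ _ _ ?h")
proof -
  have inj: "d = d'" if "d \<in> carrier D_inf" "d' \<in> carrier D_inf" "hpi D_inf_top n d = hpi D_inf_top n d'"
    for d d' n using that by (simp add: hpi_inj topspace_scott_topology)
  have hom: "DD_inf_app (?h a) (?h b) = ?h (app_inf a b)"
    if "a \<in> carrier D_inf" "b \<in> carrier D_inf" for a b
    using that by (simp add: DD_inf_app_def DD_app_hpi)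
  have mem: "?h d \<in> DD_inf" if "d \<in> carrier D_inf" for d
    using that by (simp add: DD_inf_def DD_def DD_src_hpi DD_tgt_hpi)
  have surj: "x \<in> ?h ` carrier D_inf" if x: "x \<in> DD_inf" for x
  proof -
    \<comment> \<open>Each level gets a base point of its own first; the source map then forces
      consecutive base points to coincide.\<close>
    have "\<forall>n. \<exists>d\<in>carrier D_inf. x n = hpi D_inf_top n d"
      using x by (auto simp: DD_inf_def DD_def)
    then obtain e where e: "\<And>n. e n \<in> carrier D_inf" "\<And>n. x n = hpi D_inf_top n (e n)" by metis
    have "DD_src n (x (Suc n)) = x n" for n using x by (simp add: DD_inf_def)
    then have step: "e (Suc n) = e n" for n
      using inj[OF e(1) e(1), of n "Suc n" n] by (simp add: e(2) DD_src_hpi[OF e(1)])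
    have const: "e n = e 0" for n by (induction n) (simp_all add: step)
    have "x = ?h (e 0)"
    proof
      show "x n = hpi D_inf_top n (e 0)" for n unfolding e(2) by (rule arg_cong[OF const])
    qed
    then show ?thesis using e(1) by blast
  qed
  have img: "?h ` carrier D_inf = DD_inf" using mem surj by blast
  have "inj_on ?h (carrier D_inf)"
    \<comment> \<open>Level \<open>0\<close> already separates points, as it is the base point
      itself.\<close>
    by (rule inj_onI) (rule inj[OF _ _ fun_cong[where x = 0]])
  then have "bij_betw ?h (carrier D_inf) DD_inf" using img by (simp add: bij_betw_def)
  moreover have "applicative_structure (carrier D_inf) app_inf"
    by (simp add: applicative_structure_def app_inf_closed)
  moreover have "applicative_structure DD_inf DD_inf_app"
    unfolding applicative_structure_def img[symmetric] by (auto simp: hom app_inf_closed)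
  ultimately show ?thesis by (simp add: applicative_iso_def hom)
qed

theorem theorem5p1:
  shows "(\<exists>h. applicative_iso (carrier D_inf) app_inf DD_inf DD_inf_app h) \<and>
         (\<exists>interp. extensional_lambda_model DD_inf DD_inf_app interp)"
proof (intro conjI exI)
  interpret D_inf: extensional_reflexive_cpo D_inf app_inf lam_inf
  proof (rule extensional_reflexive_cpo.intro)
    show "\<exists>u. is_lub D_inf u X" if "directed D_inf X" for X
      using D_inf_directed_lub[OF that] by blast
  qed (fact D_inf_partial_order D_inf_two_elements scott_continuous_app_inf_left
      scott_continuous_app_inf_right app_inf_extensional lam_inf_closed app_inf_lam_inf)+
  show "extensional_lambda_model DD_inf DD_inf_app
      (\<lambda>M \<rho>. (\<lambda>n. hpi D_inf_top n (D_inf.interp M (inv_into (carrier D_inf) (\<lambda>d n. hpi D_inf_top n d) \<circ> \<rho>))))"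
    using extensional_lambda_model_transfer[OF D_inf.extensional_lambda_model applicative_iso_hpi] .
qed (rule applicative_iso_hpi)

end
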